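(* Let $G$ be a $2k$-regular graph with $n$ vertices, and let $v$ be a vertex of $G$ without self-loops. Label the $k(n-2)$ edges of $G\setminus v$ by $1,\dots,k(n-2)$. Then $$[x_1\cdots x_{k(n-2)}]\,\widetilde\Psi_{G\setminus v}^{\,k}=k!\cdot\mathsf M(G).$$
   Context: Graphs are finite and undirected, and may have multiple edges and self-loops. A graph is $2k$-regular if every vertex has degree $2k$ (a self-loop counts $2$). $G\setminus v$ deletes $v$ and its incident edges. Kirchhoff polynomial. For a graph $H$ with edges labelled $1,\dots,m$, $\widetilde\Psi_H=\sum_T\prod_{e\in T}x_e$, summed over spanning trees $T$ of $H$. The notation $[x^m]F$ is the coefficient of the monomial $x^m$ in $F$. Transitions. Let $u$ be a vertex without self-loops, with edges $e_i=uw_i$. A transition at $u$ is a partition $\tau$ of these $2k$ edges into pairs; $\mathcal T(u)$ is the set of transitions. The graph $G_\tau$ deletes $u$ and its incident edges and adds an edge $w_iw_j$ for each pair $\{e_i,e_j\}\in\tau$. Martin invariant. For $2k$-regular graphs with at least 3 vertices: - $\mathsf M(G)=0$ if $G$ has a self-loop; - $\mathsf M(G)=1$ if $G$ has 3 vertices and no self-loop; - otherwise $\mathsf M(G)=\sum_{\tau\in\mathcal T(u)}\mathsf M(G_\tau)$ for any vertex $u$; this is independent of $u$. For the two-vertex graph $K_2^{[2k]}$ (two vertices joined by $2k$ parallel edges), the paper's general definition of the Martin invariant gives $\mathsf M(K_2^{[2k]})=1/k!$. *)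

theory Defs
  imports Complex_Main "HOL-Library.Multiset" "HOL-Library.Disjoint_Sets" "HOL-Library.Poly_Mapping"
begin

section \<open>Finite undirected multigraphs\<close>

text \<open>
  The ends of an edge form a multiset of size two, so a self-loop at \<open>x\<close> has ends \<open>{#x, x#}\<close>
  and contributes 2 to the degree of \<open>x\<close>. Parallel edges are distinct elements of \<open>medges\<close>.
\<close>

record ('v, 'e) mgraph =
  mverts :: "'v set"
  medges :: "'e set"
  mends :: "'e \<Rightarrow> 'v multiset"

definition mgraph_wf :: "('v, 'e) mgraph \<Rightarrow> bool" where
  "mgraph_wf G \<longleftrightarrow> finite (mverts G) \<and> finite (medges G) \<and>
     (\<forall>e\<in>medges G. size (mends G e) = 2 \<and> set_mset (mends G e) \<subseteq> mverts G)"

definition mincident :: "('v, 'e) mgraph \<Rightarrow> 'v \<Rightarrow> 'e set" where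
  "mincident G u = {e \<in> medges G. u \<in># mends G e}"

definition mdegree :: "('v, 'e) mgraph \<Rightarrow> 'v \<Rightarrow> nat" where
  "mdegree G u = (\<Sum>e\<in>medges G. count (mends G e) u)"

definition mregular :: "nat \<Rightarrow> ('v, 'e) mgraph \<Rightarrow> bool" where
  "mregular d G \<longleftrightarrow> (\<forall>u\<in>mverts G. mdegree G u = d)"

definition mloop_at :: "('v, 'e) mgraph \<Rightarrow> 'v \<Rightarrow> bool" where
  "mloop_at G u \<longleftrightarrow> (\<exists>e\<in>medges G. mends G e = {#u, u#})"

definition mdelete :: "('v, 'e) mgraph \<Rightarrow> 'v \<Rightarrow> ('v, 'e) mgraph" where
  "mdelete G u =
     \<lparr>mverts = mverts G - {u}, medges = medges G - mincident G u, mends = mends G\<rparr>"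


section \<open>Kirchhoff polynomial\<close>

definition mconnected :: "('v, 'e) mgraph \<Rightarrow> bool" where
  "mconnected H \<longleftrightarrow> mverts H \<noteq> {} \<and>
     (\<forall>a\<in>mverts H. \<forall>b\<in>mverts H. (a, b) \<in> {(x, y). \<exists>e\<in>medges H. mends H e = {#x, y#}}\<^sup>*)"

text \<open>A cycle of length 1 is a self-loop, a cycle of length 2 is a pair of parallel edges.\<close>

definition mcycle :: "('v, 'e) mgraph \<Rightarrow> 'v list \<Rightarrow> 'e list \<Rightarrow> bool" where
  "mcycle H vs es \<longleftrightarrow> es \<noteq> [] \<and> length vs = length es \<and> distinct vs \<and> distinct es \<and>
     set es \<subseteq> medges H \<and>
     (\<forall>i<length es. mends H (es ! i) = {#vs ! i, vs ! (Suc i mod length es)#})"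

definition mtree :: "('v, 'e) mgraph \<Rightarrow> bool" where
  "mtree H \<longleftrightarrow> mconnected H \<and> (\<nexists>vs es. mcycle H vs es)"

definition mspanning_trees :: "('v, 'e) mgraph \<Rightarrow> 'e set set" where
  "mspanning_trees H = {T. T \<subseteq> medges H \<and> mtree (H\<lparr>medges := T\<rparr>)}"

text \<open>
  Integer polynomials in the variables \<open>x\<^sub>i\<close>, \<open>i :: nat\<close>, are finitely supported maps from
  monomials to coefficients, and monomials are finitely supported maps from variables to
  exponents. \<open>Poly_Mapping.lookup F m\<close> is the coefficient of the monomial \<open>m\<close>.
\<close>

type_synonym int_mpoly = "(nat \<Rightarrow>\<^sub>0 nat) \<Rightarrow>\<^sub>0 int"

definition mpvar :: "nat \<Rightarrow> int_mpoly" where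
  "mpvar i = Poly_Mapping.single (Poly_Mapping.single i 1) 1"

definition kirchhoff :: "('e \<Rightarrow> nat) \<Rightarrow> ('v, 'e) mgraph \<Rightarrow> int_mpoly" where
  "kirchhoff lab H = (\<Sum>T\<in>mspanning_trees H. \<Prod>e\<in>T. mpvar (lab e))"

definition squarefree_monomial :: "nat \<Rightarrow> nat \<Rightarrow>\<^sub>0 nat" where
  "squarefree_monomial m = (\<Sum>i=1..m. Poly_Mapping.single i 1)"


section \<open>Transitions and the Martin invariant\<close>

definition mtransitions :: "('v, 'e) mgraph \<Rightarrow> 'v \<Rightarrow> 'e set set set" where
  "mtransitions G u = {\<tau>. partition_on (mincident G u) \<tau> \<and> (\<forall>p\<in>\<tau>. card p = 2)}"

text \<open>
  The edge that replaces a pair \<open>p = {e, e'}\<close> reuses one of the two names \<open>e\<close>, \<open>e'\<close>, chosen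
  arbitrarily, so that the type of edges stays the same. If \<open>e\<close> and \<open>e'\<close> have
  ends \<open>{#u, w#}\<close> and \<open>{#u, w'#}\<close>, the ends of the new edge are \<open>{#w, w'#}\<close>.
\<close>

definition mresolve :: "('v, 'e) mgraph \<Rightarrow> 'v \<Rightarrow> 'e set set \<Rightarrow> ('v, 'e) mgraph" where
  "mresolve G u \<tau> =
     \<lparr>mverts = mverts G - {u},
      medges = (medges G - mincident G u) \<union> (\<lambda>p. SOME e. e \<in> p) ` \<tau>,
      mends = (\<lambda>e. if e \<in> mincident G u
                   then (\<Sum>e'\<in>(THE p. p \<in> \<tau> \<and> e \<in> p). mends G e' - {#u#})
                   else mends G e)\<rparr>"

text \<open>
  The value is meaningful for \<open>2k\<close>-regular graphs with at least two vertices. The recursion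
  expands at an arbitrarily chosen vertex, as the result does not depend on this choice. On two
  vertices, a loopless \<open>2k\<close>-regular graph consists of \<open>2k\<close> parallel edges.
\<close>

function martin :: "('v, 'e) mgraph \<Rightarrow> rat" where
  "martin G =
     (if \<exists>u. mloop_at G u then 0
      else if card (mverts G) < 2 then 0
      else if card (mverts G) = 2 then 1 / fact (card (medges G) div 2)
      else if card (mverts G) = 3 then 1
      else (let u = (SOME u. u \<in> mverts G) in
              \<Sum>\<tau>\<in>mtransitions G u. martin (mresolve G u \<tau>)))"
  by pat_completeness auto
termination
proof (relation "Wellfounded.measure (\<lambda>G. card (mverts G))", goal_cases)
  case 1
  show ?case by simp
next
  case (2 G u \<tau>)
  have "card (mverts G) > 0" using 2 by linarith
  then have "finite (mverts G)" "mverts G \<noteq> {}" by (auto simp: card_gt_0_iff)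
  moreover from this have "u \<in> mverts G" using 2 by (simp add: some_in_eq)
  ultimately show ?case by (simp add: mresolve_def card_gt_0_iff)
qed

declare martin.simps [simp del]


section \<open>The number of edges left after deleting a vertex\<close>

lemma sum_count_mends:
  assumes "mgraph_wf G" "e \<in> medges G"
  shows "(\<Sum>u\<in>mverts G. count (mends G e) u) = 2"
proof -
  have "(\<Sum>u\<in>mverts G. count (mends G e) u) = (\<Sum>u\<in>set_mset (mends G e). count (mends G e) u)"
    using assms by (intro sum.mono_neutral_right) (auto simp: mgraph_wf_def count_eq_zero_iff)
  then show ?thesis
    using assms by (simp add: mgraph_wf_def size_multiset_overloaded_eq)
qed

lemma card_mincident:
  assumes "mgraph_wf G" "\<not> mloop_at G u"
  shows "card (mincident G u) = mdegree G u"
proof -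
  have c: "count (mends G e) u = 1" if "e \<in> mincident G u" for e
  proof -
    have e: "e \<in> medges G" "u \<in># mends G e" using that by (auto simp: mincident_def)
    then obtain M where M: "mends G e = add_mset u M" by (metis insert_DiffM)
    moreover have "size M = 1" using assms(1) e M by (auto simp: mgraph_wf_def)
    then obtain w where "M = {#w#}" by (metis size_1_singleton_mset)
    ultimately have "mends G e = {#u, w#}" by simp
    moreover from this have "w \<noteq> u" using assms(2) e by (auto simp: mloop_at_def)
    ultimately show ?thesis by simp
  qed
  have "mdegree G u = (\<Sum>e\<in>mincident G u. count (mends G e) u)"
    unfolding mdegree_def using assms(1)
    by (intro sum.mono_neutral_right) (auto simp: mgraph_wf_def mincident_def not_in_iff)
  then show ?thesis using c by simp
qed

lemma card_medges_mdelete: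
  assumes wf: "mgraph_wf G" and reg: "mregular (2 * k) G"
    and v: "v \<in> mverts G" "\<not> mloop_at G v"
  shows "card (medges (mdelete G v)) = k * (card (mverts G) - 2)"
proof -
  have "2 * card (medges G) = (\<Sum>e\<in>medges G. \<Sum>u\<in>mverts G. count (mends G e) u)"
    using wf by (simp add: sum_count_mends)
  also have "\<dots> = (\<Sum>u\<in>mverts G. mdegree G u)"
    unfolding mdegree_def by (rule sum.swap)
  also have "\<dots> = card (mverts G) * (2 * k)"
    using reg by (simp add: mregular_def)
  finally have E: "card (medges G) = k * card (mverts G)" by simp
  have "finite (mincident G v)" "mincident G v \<subseteq> medges G"
    using wf by (auto simp: mgraph_wf_def mincident_def)
  then have "card (medges (mdelete G v)) = card (medges G) - card (mincident G v)"
    by (simp add: mdelete_def card_Diff_subset)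
  also have "\<dots> = k * card (mverts G) - 2 * k"
    using E card_mincident[OF wf v(2)] reg v(1) by (simp add: mregular_def)
  finally show ?thesis by (simp add: diff_mult_distrib2 mult.commute)
qed

end

theory Submission
  imports Defs
begin

text \<open>
  The coefficient counts the ordered partitions of the edges of \<open>G \<setminus> v\<close> into \<open>k\<close> spanning trees.
  We show that this count satisfies the Martin recursion at every vertex \<open>u \<noteq> v\<close>. Fix how the edges
  avoiding \<open>u\<close> and \<open>v\<close> are distributed into forests \<open>F\<^sub>1, \<dots>, F\<^sub>k\<close>, let \<open>y\<^sub>h\<close> be a variable for every edge \<open>h\<close>
  from \<open>u\<close> to a vertex other than \<open>v\<close>, and let \<open>Y\<^sub>C\<close> be the sum of the \<open>y\<^sub>h\<close> over the \<open>h\<close> that end in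
  the component \<open>C\<close> of \<open>F\<^sub>i\<close>. The ways to complete the \<open>F\<^sub>i\<close> to spanning trees by edges at \<open>u\<close> are counted by the
  squarefree coefficient of the product over \<open>i\<close> of the stars \<open>S\<^sub>i = \<Prod>\<^sub>C Y\<^sub>C\<close>. The ways to complete
  them by the new edges of a transition are counted by that of \<open>Y\<^sup>m \<Prod>\<^sub>i T\<^sub>i\<close>, where \<open>Y\<close> is the sum
  of all \<open>y\<^sub>h\<close>, \<open>m\<close> is the number of edges \<open>uv\<close>, and \<open>T\<^sub>i\<close> enumerates the trees on the
  components of \<open>F\<^sub>i\<close>. By Cayley's formula \<open>T\<^sub>i = S\<^sub>i Y\<^bsup>c - 2\<^esup>\<close> when \<open>F\<^sub>i\<close> has
  \<open>c\<close> components, and comparing degrees the powers of \<open>Y\<close> cancel.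

  The Martin recursion expands at a vertex that may be \<open>v\<close> itself. However, the count does not depend on
  \<open>v\<close>: given \<open>v\<close> and \<open>w\<close>, expand at a third vertex and use induction.
\<close>

section \<open>Connected edge sets and spanning trees\<close>

text \<open>Vertices and edges are of arbitrary types and \<open>ends\<close> is a bare function. A
  contraction then only replaces the vertex set and \<open>ends\<close>, and the pairs of a matching
  can serve as edges.\<close>

definition edge_rel :: "('e \<Rightarrow> 'c multiset) \<Rightarrow> 'e set \<Rightarrow> ('c \<times> 'c) set" where
  "edge_rel ends T = {(x, y). \<exists>e\<in>T. ends e = {#x, y#}}"

definition connects :: "'c set \<Rightarrow> ('e \<Rightarrow> 'c multiset) \<Rightarrow> 'e set \<Rightarrow> bool" where
  "connects V ends T \<longleftrightarrow> V \<noteq> {} \<and> (\<forall>a\<in>V. \<forall>b\<in>V. (a, b) \<in> (edge_rel ends T)\<^sup>*)"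

definition component :: "('e \<Rightarrow> 'c multiset) \<Rightarrow> 'e set \<Rightarrow> 'c \<Rightarrow> 'c set" where
  "component ends T x = (edge_rel ends T)\<^sup>* `` {x}"

lemma sym_edge_rel: "sym (edge_rel ends T)"
  by (auto simp: sym_def edge_rel_def add_mset_commute)

lemma edge_rel_rtrancl_sym: "(a, b) \<in> (edge_rel ends T)\<^sup>* \<Longrightarrow> (b, a) \<in> (edge_rel ends T)\<^sup>*"
  by (meson sym_edge_rel sym_rtrancl symD)

lemma edge_rel_mono: "S \<subseteq> T \<Longrightarrow> edge_rel ends S \<subseteq> edge_rel ends T"
  by (auto simp: edge_rel_def)

lemma edge_rel_Un: "edge_rel ends (S \<union> T) = edge_rel ends S \<union> edge_rel ends T"
  by (auto simp: edge_rel_def)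

lemma edge_rel_empty [simp]: "edge_rel ends {} = {}"
  by (auto simp: edge_rel_def)

lemma edge_rel_cong: "(\<And>e. e \<in> T \<Longrightarrow> ends e = ends' e) \<Longrightarrow> edge_rel ends T = edge_rel ends' T"
  by (auto simp: edge_rel_def)

lemma connects_cong: "(\<And>e. e \<in> T \<Longrightarrow> ends e = ends' e) \<Longrightarrow> connects V ends T = connects V ends' T"
  unfolding connects_def using edge_rel_cong[of T ends ends'] by simp

lemma component_eq_iff: "component ends T a = component ends T b \<longleftrightarrow> (a, b) \<in> (edge_rel ends T)\<^sup>*"
  unfolding component_def
  by (auto intro: rtrancl_trans dest: edge_rel_rtrancl_sym)

lemma pair_mset_eq_iff: "{#a, b#} = {#x, y#} \<longleftrightarrow> (a = x \<and> b = y) \<or> (a = y \<and> b = x)"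
  by (auto simp: add_eq_conv_ex)

lemma size_2_mset: "size M = 2 \<Longrightarrow> \<exists>a b. M = {#a, b#}"
proof -
  assume "size M = 2"
  then obtain a N where N: "M = add_mset a N" "size N = 1"
    by (metis Suc_1 size_add_mset size_eq_Suc_imp_eq_union nat.inject)
  then obtain b where "N = {#b#}" by (metis size_1_singleton_mset)
  then show ?thesis using N(1) by blast
qed

section \<open>Contraction of edge sets\<close>

lemma edge_rel_image_mset:
  assumes "\<And>e. e \<in> T \<Longrightarrow> size (ends e) = 2"
  shows "edge_rel (\<lambda>e. image_mset f (ends e)) T = map_prod f f ` edge_rel ends T"
proof (rule set_eqI, clarify)
  fix x y
  show "(x, y) \<in> edge_rel (\<lambda>e. image_mset f (ends e)) T \<longleftrightarrow> (x, y) \<in> map_prod f f ` edge_rel ends T"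
  proof
    assume "(x, y) \<in> edge_rel (\<lambda>e. image_mset f (ends e)) T"
    then obtain e where e: "e \<in> T" "image_mset f (ends e) = {#x, y#}" by (auto simp: edge_rel_def)
    obtain a b where ab: "ends e = {#a, b#}" using assms[OF e(1)] size_2_mset by blast
    then have "(f a = x \<and> f b = y) \<or> (f b = x \<and> f a = y)"
      using e(2) by (auto simp: pair_mset_eq_iff)
    then have "(x, y) = map_prod f f (a, b) \<or> (x, y) = map_prod f f (b, a)" by auto
    moreover have "(a, b) \<in> edge_rel ends T" "(b, a) \<in> edge_rel ends T"
      using e(1) ab by (auto simp: edge_rel_def add_mset_commute)
    ultimately show "(x, y) \<in> map_prod f f ` edge_rel ends T" by blast
  next
    assume "(x, y) \<in> map_prod f f ` edge_rel ends T"
    then obtain a b e where "e \<in> T" "ends e = {#a, b#}" "x = f a" "y = f b"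
      by (auto simp: edge_rel_def)
    then show "(x, y) \<in> edge_rel (\<lambda>e. image_mset f (ends e)) T"
      by (auto simp: edge_rel_def intro!: bexI[of _ e])
  qed
qed

text \<open>A step in \<open>R\<close> does not move the image under \<open>f\<close>. Conversely,
  an image step lifts to a step in \<open>S\<close>, and the gaps between consecutive lifts lie
  inside fibres of \<open>f\<close>, which are bridged by \<open>R\<close>-paths.\<close>

lemma rtrancl_contract:
  assumes f: "\<And>a b. f a = f b \<longleftrightarrow> (a, b) \<in> R\<^sup>*"
  shows "(a, b) \<in> (R \<union> S)\<^sup>* \<longleftrightarrow> (f a, f b) \<in> (map_prod f f ` S)\<^sup>*"
proof
  assume "(a, b) \<in> (R \<union> S)\<^sup>*"
  then show "(f a, f b) \<in> (map_prod f f ` S)\<^sup>*"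
  proof induction
    case (step y z)
    show ?case
    proof (cases "(y, z) \<in> R")
      case True
      then have "f y = f z" using f by blast
      then show ?thesis using step.IH by simp
    next
      case False
      then have "(f y, f z) \<in> map_prod f f ` S" using step.hyps by force
      then show ?thesis using step.IH by (rule rtrancl_into_rtrancl[rotated])
    qed
  qed simp
next
  have sub: "(p, q) \<in> (R \<union> S)\<^sup>*" if "f p = f q" for p q
  proof -
    have "(p, q) \<in> R\<^sup>*" using f that by simp
    moreover have "R\<^sup>* \<subseteq> (R \<union> S)\<^sup>*" by (rule rtrancl_mono) simp
    ultimately show ?thesis by (rule subsetD[rotated])
  qed
  \<comment> \<open>All preimages of the end point are covered, because the next step may start from
    a preimage other than the one just reached.\<close>
  have "\<forall>b. f b = z \<longrightarrow> (a, b) \<in> (R \<union> S)\<^sup>*" if "(f a, z) \<in> (map_prod f f ` S)\<^sup>*" for z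
    using that
  proof induction
    case base
    show ?case using sub by simp
  next
    case (step y z)
    then obtain p q where pq: "(p, q) \<in> S" "f p = y" "f q = z" by auto
    have "(a, p) \<in> (R \<union> S)\<^sup>*" using step.IH pq(2) by simp
    moreover have "(p, q) \<in> R \<union> S" using pq(1) by simp
    ultimately have "(a, q) \<in> (R \<union> S)\<^sup>*" by (rule rtrancl_into_rtrancl)
    then show ?case using sub pq(3) by (metis rtrancl_trans)
  qed
  then show "(f a, f b) \<in> (map_prod f f ` S)\<^sup>* \<Longrightarrow> (a, b) \<in> (R \<union> S)\<^sup>*" by blast
qed

lemma edge_rel_contract:
  assumes "\<And>a b. f a = f b \<longleftrightarrow> (a, b) \<in> (edge_rel ends F)\<^sup>*"
    and "\<And>e. e \<in> T \<Longrightarrow> size (ends e) = 2"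
  shows "(a, b) \<in> (edge_rel ends (F \<union> T))\<^sup>* \<longleftrightarrow>
    (f a, f b) \<in> (edge_rel (\<lambda>e. image_mset f (ends e)) T)\<^sup>*"
proof -
  have "edge_rel (\<lambda>e. image_mset f (ends e)) T = map_prod f f ` edge_rel ends T"
    by (rule edge_rel_image_mset) (rule assms(2))
  then show ?thesis
    unfolding edge_rel_Un by (simp only:) (rule rtrancl_contract, rule assms(1))
qed

text \<open>Applied both to a single edge, with \<open>f\<close> identifying its ends, and to a
  whole edge class, with \<open>f\<close> its component map.\<close>

lemma connects_contract:
  assumes "\<And>a b. f a = f b \<longleftrightarrow> (a, b) \<in> (edge_rel ends F)\<^sup>*"
    and "\<And>e. e \<in> T \<Longrightarrow> size (ends e) = 2"
  shows "connects V ends (F \<union> T) \<longleftrightarrow> connects (f ` V) (\<lambda>e. image_mset f (ends e)) T"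
proof -
  have "(a, b) \<in> (edge_rel ends (F \<union> T))\<^sup>* \<longleftrightarrow>
      (f a, f b) \<in> (edge_rel (\<lambda>e. image_mset f (ends e)) T)\<^sup>*" for a b
    by (rule edge_rel_contract) (fact assms)+
  then show ?thesis by (simp add: connects_def)
qed

text \<open>Contracts an edge \<open>xy\<close> by giving both ends the name \<open>x\<close>. The
  type of vertices stays the same, as needed in inductions that contract an edge in every
  step.\<close>

definition merge :: "'c \<Rightarrow> 'c \<Rightarrow> 'c \<Rightarrow> 'c" where
  "merge x y z = (if z = y then x else z)"

lemma merge_eq_iff:
  assumes "ends e = {#x, y#}"
  shows "merge x y a = merge x y b \<longleftrightarrow> (a, b) \<in> (edge_rel ends {e})\<^sup>*"
proof
  have xy: "(x, y) \<in> edge_rel ends {e}" "(y, x) \<in> edge_rel ends {e}"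
    using assms by (auto simp: edge_rel_def add_mset_commute)
  assume "merge x y a = merge x y b"
  then have "a = b \<or> (a, b) \<in> edge_rel ends {e}"
    using xy by (auto simp: merge_def split: if_splits)
  then show "(a, b) \<in> (edge_rel ends {e})\<^sup>*" by auto
next
  assume "(a, b) \<in> (edge_rel ends {e})\<^sup>*"
  then show "merge x y a = merge x y b"
  proof induction
    case (step b c)
    then have "{#b, c#} = {#x, y#}" using assms by (simp add: edge_rel_def)
    then have "(b = x \<and> c = y) \<or> (b = y \<and> c = x)" unfolding pair_mset_eq_iff .
    then show ?case using step.IH by (auto simp: merge_def)
  qed simp
qed

lemma connects_merge:
  assumes "ends e = {#x, y#}" "\<And>e. e \<in> T \<Longrightarrow> size (ends e) = 2"
  shows "connects V ends (insert e T) \<longleftrightarrow>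
    connects (merge x y ` V) (\<lambda>e. image_mset (merge x y) (ends e)) T"
  using connects_contract[of "merge x y" ends "{e}" T V, OF merge_eq_iff[of ends e x y, OF assms(1)]] assms(2)
  by simp

text \<open>Contracting one edge loses at most one vertex and keeps the number of
  components.\<close>

lemma card_le_edges_plus_components:
  assumes "finite T" "finite V" "\<And>e. e \<in> T \<Longrightarrow> size (ends e) = 2"
  shows "card V \<le> card T + card (component ends T ` V)"
  using assms
proof (induction T arbitrary: V ends rule: finite_induct)
  case empty
  have "inj_on (component ends {}) V"
    by (rule inj_onI) (simp add: component_eq_iff)
  then show ?case by (simp add: card_image)
next
  case (insert e T)
  obtain x y where xy: "ends e = {#x, y#}" using insert.prems(2) size_2_mset by blast
  let ?g = "merge x y" and ?ends = "\<lambda>e. image_mset (merge x y) (ends e)"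
  have "V \<subseteq> insert y (?g ` V)" by (auto simp: merge_def)
  then have "card V \<le> card (insert y (?g ` V))" using insert.prems(1) by (intro card_mono) auto
  also have "\<dots> \<le> Suc (card (?g ` V))" by (rule card_insert_le_m1) auto
  also have "card (?g ` V) \<le> card T + card (component ?ends T ` ?g ` V)"
    using insert.prems by (intro insert.IH) auto
  also have "card (component ?ends T ` ?g ` V) = card (component ends (insert e T) ` V)"
  proof -
    have *: "component ?ends T (?g a) = component ?ends T (?g b) \<longleftrightarrow>
        component ends (insert e T) a = component ends (insert e T) b" for a b
      unfolding component_eq_iff
      using edge_rel_contract[of ?g ends "{e}" T a b, OF merge_eq_iff[of ends e x y, OF xy]] insert.prems(2) by simp
    \<comment> \<open>Sends a component to its counterpart in the contracted graph by way of a
      representative; by \<open>*\<close> the choice does not matter and the map is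
      injective.\<close>
    define h where "h = (\<lambda>z. component ?ends T (?g (inv_into V (component ends (insert e T)) z)))"
    have h: "h (component ends (insert e T) a) = component ?ends T (?g a)" if "a \<in> V" for a
      unfolding h_def using * that by (metis f_inv_into_f imageI)
    have "h ` component ends (insert e T) ` V = component ?ends T ` ?g ` V"
      using h by (simp add: image_image cong: image_cong)
    moreover have "inj_on h (component ends (insert e T) ` V)"
      using h * by (auto simp: inj_on_def)
    ultimately show ?thesis by (metis card_image)
  qed
  finally show ?case using insert.hyps by simp
qed

lemma connects_imp_card_le:
  assumes "connects V ends T" "finite T" "finite V" "\<And>e. e \<in> T \<Longrightarrow> size (ends e) = 2"
  shows "card V \<le> card T + 1"
proof -
  obtain a where "a \<in> V" using assms(1) by (auto simp: connects_def)
  then have "component ends T ` V = {component ends T a}"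
    using assms(1) component_eq_iff[of ends T] unfolding connects_def by (intro equalityI subsetI) auto
  then show ?thesis using card_le_edges_plus_components[of T V ends] assms by simp
qed

lemma connects_loop:
  assumes "ends e = {#x, x#}"
  shows "connects V ends (insert e T) \<longleftrightarrow> connects V ends T"
proof -
  have "(edge_rel ends (insert e T))\<^sup>* = (edge_rel ends T)\<^sup>*"
  proof (rule rtrancl_subset)
    show "edge_rel ends T \<subseteq> edge_rel ends (insert e T)" by (auto simp: edge_rel_def)
    show "edge_rel ends (insert e T) \<subseteq> (edge_rel ends T)\<^sup>*"
    proof (clarify)
      fix a b assume "(a, b) \<in> edge_rel ends (insert e T)"
      then have "a = b \<or> (a, b) \<in> edge_rel ends T"
        using assms by (auto simp: edge_rel_def pair_mset_eq_iff)
      then show "(a, b) \<in> (edge_rel ends T)\<^sup>*" by auto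
    qed
  qed
  then show ?thesis by (simp add: connects_def)
qed

text \<open>Greedy construction: a loop is discarded, and any other edge is taken into the tree and
  contracted, which removes exactly one vertex.\<close>

lemma exists_spanning_tree:
  assumes "finite T" "finite V" "connects V ends T"
    and "\<And>e. e \<in> T \<Longrightarrow> size (ends e) = 2 \<and> set_mset (ends e) \<subseteq> V"
  shows "\<exists>T0\<subseteq>T. connects V ends T0 \<and> card T0 + 1 = card V"
  using assms
proof (induction T arbitrary: V ends rule: finite_induct)
  case empty
  then obtain a where "V = {a}" by (auto simp: connects_def)
  then show ?case using empty by auto
next
  case (insert e T)
  obtain x y where xy: "ends e = {#x, y#}" using insert.prems(3) size_2_mset by blast
  show ?case
  proof (cases "x = y")
    case True
    then have "\<exists>T0\<subseteq>T. connects V ends T0 \<and> card T0 + 1 = card V"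
      using insert.prems xy by (intro insert.IH) (auto simp: connects_loop)
    then show ?thesis by blast
  next
    case False
    let ?g = "merge x y" and ?ends = "\<lambda>e. image_mset (merge x y) (ends e)"
    have "x \<in> V" "y \<in> V" using insert.prems(3)[of e] xy by auto
    then have V: "?g ` V = V - {y}" using False by (auto simp: merge_def)
    have "\<exists>T0\<subseteq>T. connects (?g ` V) ?ends T0 \<and> card T0 + 1 = card (?g ` V)"
    proof (rule insert.IH)
      show "connects (?g ` V) ?ends T"
        using insert.prems connects_merge[of ends e x y T V] xy by auto
    next
      fix e' assume "e' \<in> T"
      then show "size (?ends e') = 2 \<and> set_mset (?ends e') \<subseteq> ?g ` V"
        using insert.prems(3)[of e'] by auto
    qed (use insert.prems in auto)
    then obtain T0 where T0: "T0 \<subseteq> T" "connects (?g ` V) ?ends T0" "card T0 + 1 = card (?g ` V)"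
      by blast
    have "connects V ends (insert e T0)"
      using T0 insert.prems(3) connects_merge[of ends e x y T0 V] xy by blast
    moreover have "card (insert e T0) + 1 = card V"
    proof -
      have "finite T0" "e \<notin> T0" using T0(1) insert.hyps by (auto intro: finite_subset)
      moreover have "card V \<noteq> 0" using \<open>y \<in> V\<close> insert.prems(1) by auto
      ultimately show ?thesis using T0(3) V \<open>y \<in> V\<close> insert.prems(1) by simp
    qed
    ultimately show ?thesis using T0(1) by blast
  qed
qed

section \<open>Cycles, redundant edges and spanning trees\<close>

lemma simple_path:
  assumes "(x, y) \<in> (edge_rel ends T)\<^sup>*"
  shows "\<exists>vs es. length vs = Suc (length es) \<and> distinct vs \<and> set es \<subseteq> T \<and> vs ! 0 = x \<and>
    vs ! length es = y \<and> (\<forall>i<length es. ends (es ! i) = {#vs ! i, vs ! Suc i#})"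
  using assms
proof induction
  case base
  show ?case by (rule exI[of _ "[x]"], rule exI[of _ "[]"]) simp
next
  case (step y z)
  then obtain vs es e where p: "length vs = Suc (length es)" "distinct vs" "set es \<subseteq> T" "vs ! 0 = x"
      "vs ! length es = y" "\<forall>i<length es. ends (es ! i) = {#vs ! i, vs ! Suc i#}"
    and e: "e \<in> T" "ends e = {#y, z#}"
    by (auto simp: edge_rel_def)
  show ?case
  proof (cases "z \<in> set vs")
    case True
    \<comment> \<open>The walk returns to a vertex of the path, so the path is cut back to that
      vertex.\<close>
    then obtain j where j: "j < length vs" "vs ! j = z" by (auto simp: in_set_conv_nth)
    show ?thesis
    proof (intro exI conjI)
      show "length (take (Suc j) vs) = Suc (length (take j es))" using j p by simp
      show "set (take j es) \<subseteq> T" using p set_take_subset by fast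
      show "\<forall>i<length (take j es). ends (take j es ! i) = {#take (Suc j) vs ! i, take (Suc j) vs ! Suc i#}"
        using p j by auto
    qed (use p j in auto)
  next
    case False
    show ?thesis
    proof (intro exI conjI)
      show "length (vs @ [z]) = Suc (length (es @ [e]))" using p by simp
      show "\<forall>i<length (es @ [e]). ends ((es @ [e]) ! i) = {#(vs @ [z]) ! i, (vs @ [z]) ! Suc i#}"
        using p e by (auto simp: nth_append less_Suc_eq)
    qed (use p e False in \<open>auto simp: nth_append\<close>)
  qed
qed

lemma mconnected_iff: "mconnected (H\<lparr>medges := T\<rparr>) \<longleftrightarrow> connects (mverts H) (mends H) T"
  by (simp add: mconnected_def connects_def edge_rel_def)

text \<open>The rest of the cycle bypasses its last edge. For a loop \<open>l = 0\<close> and the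
  bypass is the empty path.\<close>

lemma mcycle_redundant_edge:
  assumes "mcycle (H\<lparr>medges := T\<rparr>) vs es" "connects V (mends H) T"
  shows "\<exists>e\<in>T. connects V (mends H) (T - {e})"
proof -
  define l where "l = length es - 1"
  have l: "length es = Suc l" "length vs = Suc l"
    using assms(1) by (auto simp: mcycle_def l_def)
  have d: "distinct es" "set es \<subseteq> T"
    and c: "\<And>i. i < Suc l \<Longrightarrow> mends H (es ! i) = {#vs ! i, vs ! (Suc i mod Suc l)#}"
    using assms(1) l by (auto simp: mcycle_def)
  let ?e = "es ! l" and ?R = "edge_rel (mends H) (T - {es ! l})"
  have eT: "?e \<in> T" using d l by auto
  have path: "(vs ! 0, vs ! j) \<in> ?R\<^sup>*" if "j \<le> l" for j
    using that
  proof (induction j)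
    case (Suc j)
    have "es ! j \<in> T - {?e}" using d l Suc.prems by (auto simp: nth_eq_iff_index_eq)
    moreover have "mends H (es ! j) = {#vs ! j, vs ! Suc j#}" using c[of j] Suc.prems by simp
    ultimately have "(vs ! j, vs ! Suc j) \<in> ?R" by (auto simp: edge_rel_def)
    then show ?case using Suc by (meson Suc_leD rtrancl.rtrancl_into_rtrancl)
  qed simp
  have e: "mends H ?e = {#vs ! l, vs ! 0#}" using c[of l] by simp
  have "(edge_rel (mends H) T)\<^sup>* = ?R\<^sup>*"
  proof (rule rtrancl_subset)
    show "?R \<subseteq> edge_rel (mends H) T" by (rule edge_rel_mono) blast
    show "edge_rel (mends H) T \<subseteq> ?R\<^sup>*"
    proof clarify
      fix a b assume "(a, b) \<in> edge_rel (mends H) T"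
      then consider "(a, b) \<in> ?R" | "mends H ?e = {#a, b#}" by (auto simp: edge_rel_def)
      then show "(a, b) \<in> ?R\<^sup>*"
      proof cases
        case 2
        then have "(a = vs ! l \<and> b = vs ! 0) \<or> (a = vs ! 0 \<and> b = vs ! l)"
          unfolding e pair_mset_eq_iff by blast
        then show ?thesis using path[of l] edge_rel_rtrancl_sym by auto
      qed auto
    qed
  qed
  then show ?thesis using assms(2) eT by (auto simp: connects_def)
qed

text \<open>A simple path around \<open>e\<close> is closed to a cycle by \<open>e\<close>
  itself.\<close>

lemma redundant_edge_mcycle:
  assumes "e \<in> T" "mends H e = {#x, y#}" "(x, y) \<in> (edge_rel (mends H) (T - {e}))\<^sup>*"
  shows "\<exists>vs es. mcycle (H\<lparr>medges := T\<rparr>) vs es"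
proof -
  obtain vs es where p: "length vs = Suc (length es)" "distinct vs" "set es \<subseteq> T - {e}" "vs ! 0 = x"
      "vs ! length es = y" "\<And>i. i < length es \<Longrightarrow> mends H (es ! i) = {#vs ! i, vs ! Suc i#}"
    using simple_path[OF assms(3)] by blast
  \<comment> \<open>The ends of an edge sit at the positions \<open>i\<close> and
    \<open>Suc i\<close> of a list of distinct vertices, so they determine the index of the
    edge.\<close>
  have "distinct es"
    unfolding distinct_conv_nth
  proof (intro allI impI notI)
    fix i j assume ij: "i < length es" "j < length es" "i \<noteq> j" "es ! i = es ! j"
    then have "{#vs ! i, vs ! Suc i#} = {#vs ! j, vs ! Suc j#}" using p(6) by metis
    then have "vs ! i = vs ! j \<or> (vs ! i = vs ! Suc j \<and> vs ! Suc i = vs ! j)"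
      unfolding pair_mset_eq_iff by blast
    then show False using ij p(1,2) by (auto simp: nth_eq_iff_index_eq)
  qed
  have "mcycle (H\<lparr>medges := T\<rparr>) vs (es @ [e])"
    unfolding mcycle_def
  proof (intro conjI allI impI)
    fix i assume "i < length (es @ [e])"
    then show "mends (H\<lparr>medges := T\<rparr>) ((es @ [e]) ! i) = {#vs ! i, vs ! (Suc i mod length (es @ [e]))#}"
      using p assms(2) by (cases "i = length es") (auto simp: nth_append add_mset_commute)
  qed (use p assms \<open>distinct es\<close> in auto)
  then show ?thesis by blast
qed

text \<open>Replaces acyclicity by an edge count. A tree contains a connecting set of the right
  size, and any further edge would close a cycle. Conversely, an edge of a cycle could be removed,
  leaving too few edges to connect.\<close>

lemma mspanning_trees_eq:
  assumes wf: "mgraph_wf H"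
  shows "mspanning_trees H =
    {T. T \<subseteq> medges H \<and> connects (mverts H) (mends H) T \<and> card T + 1 = card (mverts H)}"
proof -
  have "mtree (H\<lparr>medges := T\<rparr>) \<longleftrightarrow> connects (mverts H) (mends H) T \<and> card T + 1 = card (mverts H)"
    if T: "T \<subseteq> medges H" for T
  proof
    have fin: "finite T" "finite (mverts H)"
      and ends: "\<And>e. e \<in> T \<Longrightarrow> size (mends H e) = 2 \<and> set_mset (mends H e) \<subseteq> mverts H"
      using wf T by (auto simp: mgraph_wf_def intro: finite_subset)
    {
      assume t: "mtree (H\<lparr>medges := T\<rparr>)"
      then have c: "connects (mverts H) (mends H) T" by (simp add: mtree_def mconnected_iff)
      then obtain T0 where T0: "T0 \<subseteq> T" "connects (mverts H) (mends H) T0" "card T0 + 1 = card (mverts H)"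
        using exists_spanning_tree[OF fin c ends] by blast
      have "T0 = T"
      proof (rule ccontr)
        assume "T0 \<noteq> T"
        then obtain e where e: "e \<in> T" "e \<notin> T0" using T0 by blast
        obtain x y where xy: "mends H e = {#x, y#}" using ends e size_2_mset by blast
        then have "x \<in> mverts H" "y \<in> mverts H" using ends[OF e(1)] by auto
        then have "(x, y) \<in> (edge_rel (mends H) T0)\<^sup>*" using T0 by (auto simp: connects_def)
        moreover have "(edge_rel (mends H) T0)\<^sup>* \<subseteq> (edge_rel (mends H) (T - {e}))\<^sup>*"
          using T0 e by (intro rtrancl_mono edge_rel_mono) blast
        ultimately show False using redundant_edge_mcycle[OF e(1) xy] t by (auto simp: mtree_def)
      qed
      then show "connects (mverts H) (mends H) T \<and> card T + 1 = card (mverts H)" using T0 by simp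
    }
    assume c: "connects (mverts H) (mends H) T \<and> card T + 1 = card (mverts H)"
    have False if cyc: "mcycle (H\<lparr>medges := T\<rparr>) vs es" for vs es
    proof -
      obtain e where e: "e \<in> T" "connects (mverts H) (mends H) (T - {e})"
        using mcycle_redundant_edge[OF cyc] c by blast
      then have "card (mverts H) \<le> card (T - {e}) + 1"
        using fin ends by (intro connects_imp_card_le) auto
      moreover have "card T = Suc (card (T - {e}))" using e(1) fin(1) by (simp only: card_Suc_Diff1)
      ultimately show False using c by linarith
    qed
    then show "mtree (H\<lparr>medges := T\<rparr>)" using c by (auto simp: mtree_def mconnected_iff)
  qed
  then show ?thesis unfolding mspanning_trees_def by blast
qed

section \<open>Squarefree coefficients of products\<close>

text \<open>
  The shape of the squarefree coefficients of a product of polynomials indexed by \<open>I\<close>.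
\<close>

definition csum :: "'i set \<Rightarrow> ('i \<Rightarrow> 'a set \<Rightarrow> int) \<Rightarrow> 'a set \<Rightarrow> int" where
  "csum I g S = (\<Sum>c\<in>S \<rightarrow>\<^sub>E I. \<Prod>i\<in>I. g i {s\<in>S. c s = i})"

lemma csum_cong:
  assumes "\<And>i A. i \<in> I \<Longrightarrow> A \<subseteq> S \<Longrightarrow> g i A = g' i A"
  shows "csum I g S = csum I g' S"
  unfolding csum_def using assms by (intro sum.cong prod.cong) auto

lemma csum_empty:
  fixes g :: "'i \<Rightarrow> 'a set \<Rightarrow> int"
  shows "csum {} g S = (if S = {} then 1 else 0)"
proof (cases "S = {}")
  case False
  then have "S \<rightarrow>\<^sub>E {} = ({} :: ('a \<Rightarrow> 'i) set)" by (auto simp: PiE_eq_empty_iff)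
  then show ?thesis using False by (simp add: csum_def)
qed (simp add: csum_def)

lemma csum_empty_set [simp]: "finite I \<Longrightarrow> csum I g {} = (\<Prod>i\<in>I. g i {})"
  by (simp add: csum_def)

text \<open>A colouring is split into the class of colour \<open>i\<close> and a colouring of the
  remaining elements. This is the product rule behind the inductions on \<open>I\<close>.\<close>

lemma csum_insert:
  assumes "finite S" "finite I" "i \<notin> I"
  shows "csum (insert i I) g S = (\<Sum>A\<in>Pow S. g i A * csum I g (S - A))"
proof -
  have "(\<Sum>A\<in>Pow S. g i A * csum I g (S - A)) =
      (\<Sum>(A, c)\<in>(SIGMA A:Pow S. (S - A) \<rightarrow>\<^sub>E I). g i A * (\<Prod>j\<in>I. g j {s \<in> S - A. c s = j}))"
    using assms by (simp add: csum_def sum_distrib_left sum.Sigma finite_PiE)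
  also have "\<dots> = csum (insert i I) g S"
    unfolding csum_def
  proof (rule sum.reindex_bij_witness[where
        i = "\<lambda>c. ({s \<in> S. c s = i}, restrict c {s \<in> S. c s \<noteq> i})" and
        j = "\<lambda>(A, c) s. if s \<in> A then i else c s"], goal_cases)
    case (1 a)
    then obtain A c where a: "a = (A, c)" "A \<subseteq> S" "c \<in> (S - A) \<rightarrow>\<^sub>E I" by auto
    have "{s \<in> S. (if s \<in> A then i else c s) = i} = A"
      using a assms(3) by auto
    moreover have "restrict (\<lambda>s. if s \<in> A then i else c s) (S - A) = c"
      using a by (auto simp: fun_eq_iff PiE_def extensional_def)
    moreover have "{s \<in> S. (if s \<in> A then i else c s) \<noteq> i} = S - A"
      using a assms(3) by auto
    ultimately show ?case using a by simp
  next
    case (2 a)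
    then show ?case by (auto simp: PiE_def extensional_def Pi_def)
  next
    case (3 c)
    then show ?case by (auto simp: fun_eq_iff PiE_def extensional_def restrict_def)
  next
    case (4 c)
    then show ?case by (auto simp: PiE_def Pi_def)
  next
    case (5 a)
    then obtain A c where a: "a = (A, c)" "A \<subseteq> S" "c \<in> (S - A) \<rightarrow>\<^sub>E I" by auto
    have "{s \<in> S. (if s \<in> A then i else c s) = i} = A"
      using a assms(3) by auto
    moreover have "{s \<in> S. (if s \<in> A then i else c s) = j} = {s \<in> S - A. c s = j}" if "j \<in> I" for j
      using a that assms(3) by auto
    ultimately show ?case using a assms by simp
  qed
  finally show ?thesis ..
qed

text \<open>Allows the edges away from \<open>u\<close> to be coloured first, so that the edges at
  \<open>u\<close> are treated with those classes fixed.\<close>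

lemma csum_Un:
  assumes "finite A" "finite B" "finite I" "A \<inter> B = {}"
  shows "csum I g (A \<union> B) = (\<Sum>c\<in>A \<rightarrow>\<^sub>E I. csum I (\<lambda>i S. g i ({s \<in> A. c s = i} \<union> S)) B)"
proof -
  have "(\<Sum>c\<in>A \<rightarrow>\<^sub>E I. csum I (\<lambda>i S. g i ({s \<in> A. c s = i} \<union> S)) B) =
      (\<Sum>(c, d)\<in>(A \<rightarrow>\<^sub>E I) \<times> (B \<rightarrow>\<^sub>E I). \<Prod>i\<in>I. g i ({s \<in> A. c s = i} \<union> {s \<in> B. d s = i}))"
    using assms by (simp add: csum_def sum.cartesian_product)
  also have "\<dots> = csum I g (A \<union> B)"
    unfolding csum_def
  proof (rule sum.reindex_bij_witness[where
        i = "\<lambda>c. (restrict c A, restrict c B)" and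
        j = "\<lambda>(c, d) s. if s \<in> A then c s else d s"], goal_cases)
    case (1 a)
    then show ?case using assms(4) by (auto simp: fun_eq_iff PiE_def extensional_def restrict_def)
  next
    case (2 a)
    then show ?case by (auto simp: PiE_def extensional_def Pi_def)
  next
    case (3 c)
    then show ?case by (auto simp: fun_eq_iff PiE_def extensional_def restrict_def)
  next
    case (4 c)
    then show ?case by (auto simp: PiE_def Pi_def)
  next
    case (5 a)
    then obtain c d where a: "a = (c, d)" by (cases a)
    have "{s \<in> A \<union> B. (if s \<in> A then c s else d s) = i} = {s \<in> A. c s = i} \<union> {s \<in> B. d s = i}" for i
      using assms(4) by auto
    then show ?case by (simp add: a)
  qed
  finally show ?thesis ..
qed

text \<open>Passes from the edge names in a resolved graph to the pairs that they stand for.\<close>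

lemma csum_image:
  assumes "inj_on r M"
  shows "csum I g (r ` M) = csum I (\<lambda>i A. g i (r ` A)) M"
  unfolding csum_def
proof (rule sum.reindex_bij_witness[where
      i = "\<lambda>c. restrict (\<lambda>x. c (inv_into M r x)) (r ` M)" and j = "\<lambda>c. restrict (\<lambda>x. c (r x)) M"],
      goal_cases)
  case (1 c)
  then show ?case
    by (auto simp: fun_eq_iff PiE_def extensional_def restrict_def f_inv_into_f inv_into_into)
next
  case (2 c)
  then show ?case by (auto simp: PiE_def Pi_def)
next
  case (3 c)
  then show ?case
    using assms by (auto simp: fun_eq_iff PiE_def extensional_def restrict_def)
next
  case (4 c)
  then show ?case using assms by (auto simp: PiE_def Pi_def)
next
  case (5 c)
  have "r ` {s \<in> M. restrict (\<lambda>x. c (r x)) M s = i} = {s \<in> r ` M. c s = i}" for i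
    by auto
  then show ?case by simp
qed

lemma sum_card_fibres:
  assumes "finite S" "finite I" "c \<in> S \<rightarrow> I"
  shows "(\<Sum>i\<in>I. card {s \<in> S. c s = i}) = card S"
  using sum.group[of S I c "\<lambda>_. 1 :: nat"] assms by auto

section \<open>Squarefree monomials and their coefficients\<close>

definition mon :: "('e \<Rightarrow> nat) \<Rightarrow> 'e set \<Rightarrow> nat \<Rightarrow>\<^sub>0 nat" where
  "mon lab A = (\<Sum>e\<in>A. Poly_Mapping.single (lab e) 1)"

text \<open>The linear form \<open>Y\<close> of the outline.\<close>

definition hsum :: "('e \<Rightarrow> nat) \<Rightarrow> 'e set \<Rightarrow> int_mpoly" where
  "hsum lab H = (\<Sum>e\<in>H. mpvar (lab e))"

abbreviation coeff :: "int_mpoly \<Rightarrow> (nat \<Rightarrow>\<^sub>0 nat) \<Rightarrow> int" where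
  "coeff \<equiv> Poly_Mapping.lookup"

lemma lookup_mon:
  assumes "finite A" "inj_on lab A"
  shows "Poly_Mapping.lookup (mon lab A) x = (if x \<in> lab ` A then 1 else 0)"
  using assms
proof (induction A rule: finite_induct)
  case (insert a A)
  then show ?case
    by (auto simp: mon_def lookup_add lookup_single when_def)
qed (simp add: mon_def)

lemma mon_inj:
  assumes "finite S" "inj_on lab S" "A \<subseteq> S" "B \<subseteq> S" "mon lab A = mon lab B"
  shows "A = B"
proof -
  have "x \<in> lab ` A \<longleftrightarrow> x \<in> lab ` B" for x
  proof -
    have "(if x \<in> lab ` C then 1 else 0) = Poly_Mapping.lookup (mon lab C) x" if "C \<subseteq> S" for C
      using lookup_mon[of C lab x] that assms(1,2) finite_subset inj_on_subset by metis
    from this[OF assms(3)] this[OF assms(4)]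
    have "(if x \<in> lab ` A then 1 else 0 :: nat) = (if x \<in> lab ` B then 1 else 0)"
      by (simp only: assms(5))
    then show ?thesis by (simp split: if_splits)
  qed
  then have "lab ` A = lab ` B" by blast
  then show ?thesis using assms(2-4) by (simp add: inj_on_image_eq_iff)
qed

lemma mon_split:
  assumes "finite S" "A \<subseteq> S"
  shows "mon lab S = mon lab A + mon lab (S - A)"
  unfolding mon_def using sum.subset_diff[OF assms(2,1)] by (simp add: add.commute)

text \<open>A divisor of a squarefree monomial has exponents at most 1, so it is given by the
  variables that occur in it.\<close>

lemma mon_eq_addD:
  assumes "finite S" "inj_on lab S" "mon lab S = l + q"
  shows "\<exists>A\<subseteq>S. l = mon lab A"
proof (intro exI conjI)
  let ?A = "{e \<in> S. Poly_Mapping.lookup l (lab e) = 1}"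
  show "?A \<subseteq> S" by auto
  then have A: "finite ?A" "inj_on lab ?A"
    using assms by (auto intro: inj_on_subset)
  show "l = mon lab ?A"
  proof (rule poly_mapping_eqI)
    fix x
    have "Poly_Mapping.lookup (mon lab S) x = Poly_Mapping.lookup l x + Poly_Mapping.lookup q x"
      using assms(3) by (simp add: lookup_add)
    then have "Poly_Mapping.lookup l x \<le> (if x \<in> lab ` S then 1 else 0)"
      using lookup_mon[OF assms(1,2), of x] by simp
    then have "Poly_Mapping.lookup l x = (if x \<in> lab ` ?A then 1 else 0)"
      by (auto split: if_splits)
    then show "Poly_Mapping.lookup l x = Poly_Mapping.lookup (mon lab ?A) x"
      using lookup_mon[OF A] by simp
  qed
qed

text \<open>By \<open>mon_eq_addD\<close> every factorisation of a squarefree monomial splits its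
  set of variables in two, so the convolution reduces to a sum over subsets.\<close>

lemma coeff_mult_mon:
  assumes S: "finite S" "inj_on lab S"
  shows "coeff (p * q) (mon lab S) = (\<Sum>A\<in>Pow S. coeff p (mon lab A) * coeff q (mon lab (S - A)))"
proof -
  let ?f = "\<lambda>l. coeff p l * (\<Sum>r. (coeff q r when mon lab S = l + r))"
  have inj: "inj_on (mon lab) (Pow S)"
    by (rule inj_onI) (use mon_inj[OF S] in auto)
  have "coeff (p * q) (mon lab S) = Sum_any ?f"
    by (simp add: lookup_mult)
  also have "\<dots> = sum ?f (mon lab ` Pow S)"
  proof (rule Sum_any.expand_superset)
    show "finite (mon lab ` Pow S)" using S by simp
    show "{l. ?f l \<noteq> 0} \<subseteq> mon lab ` Pow S"
    proof (rule subsetI, rule ccontr)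
      fix l assume nz: "l \<in> {l. ?f l \<noteq> 0}" and l: "l \<notin> mon lab ` Pow S"
      have "(\<Sum>r. (coeff q r when mon lab S = l + r)) = (\<Sum>r :: nat \<Rightarrow>\<^sub>0 nat. 0 :: int)"
      proof (rule Sum_any.cong)
        fix r
        have "mon lab S \<noteq> l + r" using mon_eq_addD[OF S, of l r] l by auto
        then show "(coeff q r when mon lab S = l + r) = 0" by simp
      qed
      then show False using nz by simp
    qed
  qed
  also have "\<dots> = (\<Sum>A\<in>Pow S. ?f (mon lab A))"
    by (simp add: sum.reindex[OF inj])
  also have "\<dots> = (\<Sum>A\<in>Pow S. coeff p (mon lab A) * coeff q (mon lab (S - A)))"
  proof (rule sum.cong)
    fix A assume "A \<in> Pow S"
    then have "mon lab S = mon lab A + r \<longleftrightarrow> r = mon lab (S - A)" for r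
      using mon_split[of S A lab] S by auto
    then have "(\<Sum>r. (coeff q r when mon lab S = mon lab A + r)) = coeff q (mon lab (S - A))"
      by simp
    then show "?f (mon lab A) = coeff p (mon lab A) * coeff q (mon lab (S - A))" by simp
  qed simp
  finally show ?thesis .
qed

lemma mon_empty [simp]: "mon lab {} = 0"
  by (simp add: mon_def)

lemma coeff_one_mon:
  assumes "finite S" "inj_on lab S"
  shows "coeff 1 (mon lab S) = (if S = {} then 1 else 0)"
  using mon_inj[OF assms, of S "{}"] by (auto simp: lookup_one when_def)

lemma coeff_prod_mon:
  assumes "finite S" "inj_on lab S" "finite I"
  shows "coeff (\<Prod>i\<in>I. p i) (mon lab S) = csum I (\<lambda>i A. coeff (p i) (mon lab A)) S"
  using assms(3,1,2)
proof (induction I arbitrary: S rule: finite_induct)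
  case empty
  then show ?case by (simp add: csum_empty coeff_one_mon)
next
  case (insert i I)
  have "coeff (\<Prod>i\<in>insert i I. p i) (mon lab S) =
      (\<Sum>A\<in>Pow S. coeff (p i) (mon lab A) * coeff (\<Prod>i\<in>I. p i) (mon lab (S - A)))"
    using insert by (simp add: coeff_mult_mon)
  also have "\<dots> = (\<Sum>A\<in>Pow S. coeff (p i) (mon lab A) * csum I (\<lambda>i A. coeff (p i) (mon lab A)) (S - A))"
    using insert.prems by (intro sum.cong) (auto intro!: insert.IH intro: inj_on_subset)
  also have "\<dots> = csum (insert i I) (\<lambda>i A. coeff (p i) (mon lab A)) S"
    using insert by (simp add: csum_insert)
  finally show ?case .
qed

lemma coeff_single_mon:
  assumes "finite S" "inj_on lab S" "A \<subseteq> S" "B \<subseteq> S"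
  shows "coeff (Poly_Mapping.single (mon lab A) c) (mon lab B) = (if A = B then c else 0)"
  using mon_inj[OF assms] by (auto simp: lookup_single when_def)

text \<open>Any function on subsets is realised by the squarefree coefficients of a polynomial; this
  supplies a factor \<open>r\<close> in \<open>star_tree_polynomial\<close>.\<close>

lemma coeff_sum_single_mon:
  assumes "finite S" "inj_on lab S" "B \<subseteq> S"
  shows "coeff (\<Sum>A\<in>Pow S. Poly_Mapping.single (mon lab A) (f A)) (mon lab B) = f B"
proof -
  have "coeff (\<Sum>A\<in>Pow S. Poly_Mapping.single (mon lab A) (f A)) (mon lab B) =
      (\<Sum>A\<in>Pow S. if B = A then f A else 0)"
    unfolding lookup_sum using assms by (intro sum.cong) (auto simp: coeff_single_mon)
  also have "\<dots> = f B" using assms by simp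
  finally show ?thesis .
qed

lemma coeff_hsum_mult:
  assumes H: "finite H" "inj_on lab H" and S: "S \<subseteq> H"
  shows "coeff (hsum lab H * p) (mon lab S) = (\<Sum>h\<in>S. coeff p (mon lab (S - {h})))"
proof -
  have S': "finite S" "inj_on lab S" using assms by (auto intro: finite_subset inj_on_subset)
  have "coeff (hsum lab H) (mon lab A) = (\<Sum>h\<in>S. if A = {h} then 1 else 0)" if "A \<subseteq> S" for A
  proof -
    have "coeff (mpvar (lab h)) (mon lab A) = (if {h} = A then 1 else 0)" if "h \<in> H" for h
      using coeff_single_mon[OF H, of "{h}" A 1] that \<open>A \<subseteq> S\<close> S
      by (simp add: mpvar_def mon_def)
    then have "coeff (hsum lab H) (mon lab A) = (\<Sum>h\<in>H. if A = {h} then 1 else 0)"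
      unfolding hsum_def lookup_sum by (intro sum.cong) auto
    also have "\<dots> = (\<Sum>h\<in>S. if A = {h} then 1 else 0)"
      using H S that by (intro sum.mono_neutral_right) auto
    finally show ?thesis .
  qed
  then have "coeff (hsum lab H * p) (mon lab S) =
      (\<Sum>A\<in>Pow S. (\<Sum>h\<in>S. if A = {h} then 1 else 0) * coeff p (mon lab (S - A)))"
    unfolding coeff_mult_mon[OF S'] by (intro sum.cong) auto
  also have "\<dots> = (\<Sum>A\<in>Pow S. \<Sum>h\<in>S. if A = {h} then coeff p (mon lab (S - A)) else 0)"
    by (intro sum.cong) (auto simp: sum_distrib_right intro!: sum.cong)
  also have "\<dots> = (\<Sum>h\<in>S. \<Sum>A\<in>Pow S. if A = {h} then coeff p (mon lab (S - A)) else 0)"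
    by (rule sum.swap)
  also have "\<dots> = (\<Sum>h\<in>S. coeff p (mon lab (S - {h})))"
    using S' by (intro sum.cong) auto
  finally show ?thesis .
qed

text \<open>The factorial counts the orders in which the distinct variables are picked from the
  \<open>n\<close> factors.\<close>

lemma coeff_hsum_power:
  assumes H: "finite H" "inj_on lab H" and S: "S \<subseteq> H"
  shows "coeff (hsum lab H ^ n) (mon lab S) = (if card S = n then fact n else 0)"
  using S
proof (induction n arbitrary: S)
  case 0
  then have "finite S" "inj_on lab S" using H by (auto intro: finite_subset inj_on_subset)
  then show ?case using coeff_one_mon[of S lab] by auto
next
  case (Suc n)
  then have fin: "finite S" using H by (auto intro: finite_subset)
  have "coeff (hsum lab H ^ Suc n) (mon lab S) = (\<Sum>h\<in>S. if card S = Suc n then fact n else 0)"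
    unfolding power_Suc coeff_hsum_mult[OF H Suc.prems]
  proof (rule sum.cong)
    fix h assume h: "h \<in> S"
    then have "Suc (card (S - {h})) = card S" using fin by (simp only: card_Suc_Diff1)
    then have "card (S - {h}) = n \<longleftrightarrow> card S = Suc n" by linarith
    then show "coeff (hsum lab H ^ n) (mon lab (S - {h})) = (if card S = Suc n then fact n else 0)"
      using Suc.IH[of "S - {h}"] Suc.prems by (simp add: subset_iff)
  qed simp
  then show ?case by simp
qed

lemma prod_mpvar: "finite T \<Longrightarrow> (\<Prod>e\<in>T. mpvar (lab e)) = Poly_Mapping.single (mon lab T) 1"
  by (induction T rule: finite_induct) (simp_all add: mpvar_def mon_def mult_single)

text \<open>The passage from algebra to counting: the \<open>k\<close> factors become
  \<open>k\<close> colours, and every colour class has to be a spanning tree.\<close>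

lemma coeff_kirchhoff_power:
  assumes "finite (medges H)" "inj_on lab (medges H)"
  shows "coeff (kirchhoff lab H ^ k) (mon lab (medges H)) =
    csum {..<k} (\<lambda>_ T. if T \<in> mspanning_trees H then 1 else 0) (medges H)"
proof -
  have sub: "mspanning_trees H \<subseteq> Pow (medges H)" by (auto simp: mspanning_trees_def)
  then have fin: "finite (mspanning_trees H)" using assms(1) finite_subset by fast
  have *: "coeff (kirchhoff lab H) (mon lab A) = (if A \<in> mspanning_trees H then 1 else 0)"
    if "A \<subseteq> medges H" for A
  proof -
    have "coeff (kirchhoff lab H) (mon lab A) = (\<Sum>T\<in>mspanning_trees H. if A = T then 1 else 0)"
      unfolding kirchhoff_def lookup_sum
    proof (rule sum.cong)
      fix T assume "T \<in> mspanning_trees H"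
      then have T: "T \<subseteq> medges H" "finite T" using sub assms(1) by (auto intro: finite_subset)
      show "coeff (\<Prod>e\<in>T. mpvar (lab e)) (mon lab A) = (if A = T then 1 else 0)"
        unfolding prod_mpvar[OF T(2)] coeff_single_mon[OF assms T(1) that] by auto
    qed simp
    then show ?thesis using fin by simp
  qed
  have "coeff (kirchhoff lab H ^ k) (mon lab (medges H)) =
      coeff (\<Prod>i<k. kirchhoff lab H) (mon lab (medges H))" by simp
  also have "\<dots> = csum {..<k} (\<lambda>_ A. coeff (kirchhoff lab H) (mon lab A)) (medges H)"
    using assms by (intro coeff_prod_mon) auto
  also have "\<dots> = csum {..<k} (\<lambda>_ T. if T \<in> mspanning_trees H then 1 else 0) (medges H)"
    by (rule csum_cong) (simp add: *)
  finally show ?thesis .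
qed

section \<open>Perfect matchings\<close>

text \<open>Transitions without the graph: \<open>mtransitions G u\<close> is
  \<open>pmatchings (mincident G u)\<close>.\<close>

definition pmatchings :: "'a set \<Rightarrow> 'a set set set" where
  "pmatchings A = {M. partition_on A M \<and> (\<forall>p\<in>M. card p = 2)}"

lemma finite_pmatchings: "finite A \<Longrightarrow> finite (pmatchings A)"
  unfolding pmatchings_def by (rule finite_subset[OF _ finitely_many_partition_on]) auto

lemma pmatchings_empty [simp]: "pmatchings {} = {{}}"
  by (auto simp: pmatchings_def partition_on_empty)

lemma Union_pmatching: "M \<in> pmatchings A \<Longrightarrow> \<Union>M = A"
  by (simp add: pmatchings_def partition_on_def)

lemma disjoint_pmatching: "M \<in> pmatchings A \<Longrightarrow> p \<in> M \<Longrightarrow> q \<in> M \<Longrightarrow> x \<in> p \<Longrightarrow> x \<in> q \<Longrightarrow> p = q"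
  by (auto simp: pmatchings_def partition_on_def disjoint_def)

lemma card_pmatching_pair: "M \<in> pmatchings A \<Longrightarrow> p \<in> M \<Longrightarrow> card p = 2"
  by (simp add: pmatchings_def)

lemma finite_pmatching: "finite A \<Longrightarrow> M \<in> pmatchings A \<Longrightarrow> finite M"
  by (auto simp: pmatchings_def intro: finite_elements)

lemma card_pmatching:
  assumes "finite A" "M \<in> pmatchings A"
  shows "2 * card M = card A"
proof -
  have "finite p" if "p \<in> M" for p
    using card_pmatching_pair[OF assms(2) that] by (simp add: card_ge_0_finite)
  then have "card A = (\<Sum>p\<in>M. card p)"
    using assms(2) by (intro product_partition) (auto simp: pmatchings_def)
  then show ?thesis using card_pmatching_pair[OF assms(2)] by simp
qed

lemma pmatchings_Un:
  assumes "M \<in> pmatchings A" "N \<in> pmatchings B" "A \<inter> B = {}"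
  shows "M \<union> N \<in> pmatchings (A \<union> B)" "M \<inter> N = {}"
proof -
  have M: "\<Union>M = A" and N: "\<Union>N = B" using Union_pmatching assms(1,2) by blast+
  show "M \<union> N \<in> pmatchings (A \<union> B)"
    unfolding pmatchings_def partition_on_def
  proof (intro CollectI conjI ballI)
    show "disjoint (M \<union> N)"
      using assms M N by (intro disjoint_union) (auto simp: pmatchings_def partition_on_def)
  qed (use assms M N in \<open>auto simp: pmatchings_def partition_on_def\<close>)
  show "M \<inter> N = {}"
  proof (rule ccontr)
    assume "M \<inter> N \<noteq> {}"
    then obtain p where p: "p \<in> M" "p \<in> N" by blast
    then have "p \<subseteq> A \<inter> B" using M N by blast
    moreover have "card p = 2" using assms(1) p card_pmatching_pair by blast
    ultimately show False using assms(3) by auto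
  qed
qed

lemma pmatchings_subset:
  assumes "M \<in> pmatchings A" "N \<subseteq> M"
  shows "N \<in> pmatchings (\<Union>N)"
  using assms by (auto simp: pmatchings_def partition_on_def intro: pairwise_subset)

lemma Union_Diff_pmatching:
  assumes "M \<in> pmatchings A" "N \<subseteq> M"
  shows "\<Union>(M - N) = A - \<Union>N"
  using Union_pmatching[OF assms(1)] disjoint_pmatching[OF assms(1)] assms(2)
  by (intro equalityI subsetI) (blast+)

text \<open>Choosing a matching and some of its pairs amounts to choosing the set \<open>B\<close>
  that these pairs cover and then matching \<open>B\<close> and its complement separately.\<close>

lemma sum_pmatchings_split:
  fixes h :: "'a set set \<Rightarrow> 'a set set \<Rightarrow> int"
  assumes "finite A"
  shows "(\<Sum>M\<in>pmatchings A. \<Sum>N\<in>Pow M. h N (M - N)) =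
    (\<Sum>B\<in>Pow A. \<Sum>N\<in>pmatchings B. \<Sum>N'\<in>pmatchings (A - B). h N N')"
proof -
  have fin: "finite (pmatchings B)" if "B \<subseteq> A" for B
    using that assms by (intro finite_pmatchings) (rule finite_subset)
  have "(\<Sum>M\<in>pmatchings A. \<Sum>N\<in>Pow M. h N (M - N)) =
      (\<Sum>(M, N)\<in>(SIGMA M:pmatchings A. Pow M). h N (M - N))"
    using assms finite_pmatching by (subst sum.Sigma) (auto simp: finite_pmatchings)
  also have "\<dots> = (\<Sum>(B, N, N')\<in>(SIGMA B:Pow A. pmatchings B \<times> pmatchings (A - B)). h N N')"
  proof (rule sum.reindex_bij_witness[where
        i = "\<lambda>(B, N, N'). (N \<union> N', N)" and j = "\<lambda>(M, N). (\<Union>N, N, M - N)"], goal_cases)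
    case (1 a)
    then show ?case by auto
  next
    case (2 a)
    then obtain M N where a: "a = (M, N)" "M \<in> pmatchings A" "N \<subseteq> M" by auto
    have "M - N \<in> pmatchings (\<Union>(M - N))" using a by (intro pmatchings_subset[OF a(2)]) auto
    then show ?case
      using a pmatchings_subset[OF a(2,3)] Union_Diff_pmatching[OF a(2,3)] Union_pmatching[OF a(2)]
      by auto
  next
    case (3 b)
    then obtain B N N' where b: "b = (B, N, N')" "B \<subseteq> A" "N \<in> pmatchings B" "N' \<in> pmatchings (A - B)"
      by auto
    have "N \<inter> N' = {}" using pmatchings_Un(2)[OF b(3,4)] by blast
    then have "N \<union> N' - N = N'" by blast
    then show ?case using b(1) Union_pmatching[OF b(3)] by simp
  next
    case (4 b)
    then obtain B N N' where b: "b = (B, N, N')" "B \<subseteq> A" "N \<in> pmatchings B" "N' \<in> pmatchings (A - B)"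
      by auto
    have "B \<union> (A - B) = A" using b by blast
    then have "N \<union> N' \<in> pmatchings A" using pmatchings_Un(1)[OF b(3,4)] by auto
    then show ?case using b by auto
  next
    case (5 a)
    then show ?case by auto
  qed
  also have "\<dots> = (\<Sum>B\<in>Pow A. \<Sum>(N, N')\<in>pmatchings B \<times> pmatchings (A - B). h N N')"
    using assms fin by (subst sum.Sigma) auto
  also have "\<dots> = (\<Sum>B\<in>Pow A. \<Sum>N\<in>pmatchings B. \<Sum>N'\<in>pmatchings (A - B). h N N')"
    using fin by (simp add: sum.cartesian_product)
  finally show ?thesis .
qed

lemma pmatchings_singleton: "a \<noteq> b \<Longrightarrow> {{a, b}} \<in> pmatchings {a, b}"
  by (auto simp: pmatchings_def partition_on_def)

text \<open>Expansion by the partner \<open>b\<close> of a fixed element \<open>a\<close>.\<close>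

lemma sum_pmatchings_insert:
  fixes g :: "'a set set \<Rightarrow> int"
  assumes "finite A" "a \<notin> A"
  shows "(\<Sum>M\<in>pmatchings (insert a A). g M) =
    (\<Sum>b\<in>A. \<Sum>M\<in>pmatchings (A - {b}). g (insert {a, b} M))"
proof -
  let ?S = "SIGMA b:A. pmatchings (A - {b})" and ?f = "\<lambda>(b, M). insert {a, b} M"
  have fin: "finite (pmatchings (A - {b}))" for b
    using assms by (intro finite_pmatchings) auto
  have notin: "\<forall>p\<in>M. a \<notin> p" if "M \<in> pmatchings (A - {b})" for M b
    using Union_pmatching[OF that] assms(2) by blast
  have inj: "inj_on ?f ?S"
  proof (rule inj_onI, clarify)
    fix b M b' M'
    assume M: "M \<in> pmatchings (A - {b})" and M': "M' \<in> pmatchings (A - {b'})"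
      and b: "b \<in> A" "b' \<in> A" and eq: "insert {a, b} M = insert {a, b'} M'"
    have "{a, b} \<notin> M" "{a, b'} \<notin> M'" "{a, b} \<notin> M'" using notin M M' by blast+
    moreover have "{a, b} \<in> insert {a, b'} M'" using eq by (metis insertI1)
    ultimately have "{a, b} = {a, b'}" by simp
    moreover from this have "M = M'"
      using eq \<open>{a, b} \<notin> M\<close> \<open>{a, b} \<notin> M'\<close> by (metis insert_ident)
    ultimately show "b = b' \<and> M = M'" using assms(2) b by (auto simp: doubleton_eq_iff)
  qed
  have img: "?f ` ?S = pmatchings (insert a A)"
  proof (intro equalityI subsetI)
    fix N assume "N \<in> ?f ` ?S"
    then obtain b M where N: "N = insert {a, b} M" "b \<in> A" "M \<in> pmatchings (A - {b})" by auto
    have "{{a, b}} \<union> M \<in> pmatchings ({a, b} \<union> (A - {b}))"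
      using N assms(2) by (intro pmatchings_Un pmatchings_singleton) auto
    moreover have "{a, b} \<union> (A - {b}) = insert a A" using N(2) by blast
    ultimately show "N \<in> pmatchings (insert a A)" using N(1) by simp
  next
    fix N assume N: "N \<in> pmatchings (insert a A)"
    then obtain p where p: "p \<in> N" "a \<in> p" using Union_pmatching[OF N] by blast
    then obtain b where b: "p = {a, b}" "b \<noteq> a"
      using card_pmatching_pair[OF N p(1)] by (auto simp: card_2_iff)
    then have bA: "b \<in> A" using Union_pmatching[OF N] p(1) by blast
    have "N - {p} \<in> pmatchings (\<Union>(N - {p}))" using N by (rule pmatchings_subset) auto
    moreover have "\<Union>(N - {p}) = A - {b}"
      using Union_Diff_pmatching[OF N, of "{p}"] p b assms(2) by auto
    ultimately have "(b, N - {p}) \<in> ?S" using bA by simp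
    moreover have "N = ?f (b, N - {p})" using p b by auto
    ultimately show "N \<in> ?f ` ?S" by (rule rev_image_eqI)
  qed
  have "(\<Sum>M\<in>pmatchings (insert a A). g M) = (\<Sum>x\<in>?S. g (?f x))"
    unfolding img[symmetric] sum.reindex[OF inj] by simp
  also have "\<dots> = (\<Sum>b\<in>A. \<Sum>M\<in>pmatchings (A - {b}). g (insert {a, b} M))"
    using assms fin by (simp add: sum.Sigma split_beta)
  finally show ?thesis .
qed

text \<open>Colouring the pairs of a matching is the same as colouring the elements and matching
  within each colour class.\<close>

lemma sum_pmatchings_csum:
  assumes "finite I" "finite A"
  shows "(\<Sum>M\<in>pmatchings A. csum I g M) = csum I (\<lambda>i S. \<Sum>M\<in>pmatchings S. g i M) A"
  using assms
proof (induction I arbitrary: A rule: finite_induct)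
  case empty
  show ?case
  proof (cases "A = {}")
    case False
    have "M \<noteq> {}" if "M \<in> pmatchings A" for M
      using Union_pmatching[OF that] False by auto
    then show ?thesis using False by (simp add: csum_empty)
  qed (simp add: csum_empty)
next
  case (insert i I)
  have "(\<Sum>M\<in>pmatchings A. csum (insert i I) g M) =
      (\<Sum>M\<in>pmatchings A. \<Sum>N\<in>Pow M. g i N * csum I g (M - N))"
    using insert finite_pmatching by (intro sum.cong csum_insert) auto
  also have "\<dots> = (\<Sum>B\<in>Pow A. \<Sum>N\<in>pmatchings B. \<Sum>N'\<in>pmatchings (A - B). g i N * csum I g N')"
    by (rule sum_pmatchings_split) (rule insert.prems)
  also have "\<dots> = (\<Sum>B\<in>Pow A. (\<Sum>N\<in>pmatchings B. g i N) * (\<Sum>N'\<in>pmatchings (A - B). csum I g N'))"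
    by (simp add: sum_product)
  also have "\<dots> = (\<Sum>B\<in>Pow A. (\<Sum>N\<in>pmatchings B. g i N) *
      csum I (\<lambda>i S. \<Sum>M\<in>pmatchings S. g i M) (A - B))"
    using insert.prems by (simp add: insert.IH)
  also have "\<dots> = csum (insert i I) (\<lambda>i S. \<Sum>M\<in>pmatchings S. g i M) A"
    using insert by (simp add: csum_insert)
  finally show ?case .
qed

text \<open>
  The elements of \<open>B\<close> have to be matched with distinct elements of \<open>H\<close>, which is what the
  factor \<open>hsum lab H ^ card B\<close> counts.
\<close>

lemma sum_pmatchings_bipartite:
  assumes H0: "finite H0" "inj_on lab H0" and "finite B"
    and Q: "\<And>A. A \<subseteq> H0 \<Longrightarrow> coeff Q (mon lab A) = (\<Sum>M\<in>pmatchings A. g M)"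
    and "H \<subseteq> H0" "H \<inter> B = {}"
  shows "(\<Sum>M\<in>pmatchings (H \<union> B). if \<exists>p\<in>M. p \<subseteq> B then 0 else g {p \<in> M. p \<subseteq> H}) =
    coeff (hsum lab H0 ^ card B * Q) (mon lab H)"
  using assms(3,5,6)
\<comment> \<open>\<open>H\<close> loses the partner of \<open>b\<close> in each step, while the
  variables and \<open>Q\<close> belong to the fixed set \<open>H0\<close>.\<close>
proof (induction B arbitrary: H rule: finite_induct)
  case empty
  have "(if \<exists>p\<in>M. p \<subseteq> {} then 0 else g {p \<in> M. p \<subseteq> H}) = g M" if M: "M \<in> pmatchings H" for M
  proof -
    have "\<not> p \<subseteq> {}" if "p \<in> M" for p using card_pmatching_pair[OF M that] by auto
    moreover have "{p \<in> M. p \<subseteq> H} = M" using Union_pmatching[OF M] by blast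
    ultimately show ?thesis by auto
  qed
  then show ?case using empty Q by simp
next
  case (insert b B)
  have fin: "finite (H \<union> B)" and b: "b \<notin> H \<union> B" and disj: "H \<inter> B = {}"
    using insert H0 by (auto intro: finite_subset)
  let ?w = "\<lambda>H B M. if \<exists>p\<in>M. p \<subseteq> B then 0 else g {p \<in> M. p \<subseteq> H}"
  have "(\<Sum>M\<in>pmatchings (H \<union> insert b B). ?w H (insert b B) M) =
      (\<Sum>x\<in>H \<union> B. \<Sum>M\<in>pmatchings (H \<union> B - {x}). ?w H (insert b B) (insert {b, x} M))"
    using sum_pmatchings_insert[OF fin b, of "?w H (insert b B)"] by simp
  \<comment> \<open>A partner in \<open>B\<close> makes a pair inside \<open>insert b B\<close>,
    which has weight 0.\<close>
  also have "\<dots> = (\<Sum>x\<in>H. \<Sum>M\<in>pmatchings (H \<union> B - {x}). ?w H (insert b B) (insert {b, x} M))"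
    using fin disj by (intro sum.mono_neutral_right) auto
  also have "\<dots> = (\<Sum>x\<in>H. coeff (hsum lab H0 ^ card B * Q) (mon lab (H - {x})))"
  proof (rule sum.cong)
    fix x assume x: "x \<in> H"
    have eq: "H \<union> B - {x} = (H - {x}) \<union> B" using x disj by blast
    have "?w H (insert b B) (insert {b, x} M) = ?w (H - {x}) B M"
      if M: "M \<in> pmatchings (H \<union> B - {x})" for M
    proof -
      have U: "\<Union>M = H \<union> B - {x}" by (rule Union_pmatching[OF M])
      have "(\<exists>p\<in>insert {b, x} M. p \<subseteq> insert b B) \<longleftrightarrow> (\<exists>p\<in>M. p \<subseteq> B)"
      proof
        assume "\<exists>p\<in>insert {b, x} M. p \<subseteq> insert b B"
        then obtain p where "p \<in> M" "p \<subseteq> insert b B" using x insert.prems(2) b by auto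
        moreover have "b \<notin> p" using U b \<open>p \<in> M\<close> by blast
        ultimately show "\<exists>p\<in>M. p \<subseteq> B" by blast
      qed blast
      moreover have "{p \<in> insert {b, x} M. p \<subseteq> H} = {p \<in> M. p \<subseteq> H - {x}}"
        using b U by blast
      ultimately show ?thesis by simp
    qed
    then have "(\<Sum>M\<in>pmatchings (H \<union> B - {x}). ?w H (insert b B) (insert {b, x} M)) =
        (\<Sum>M\<in>pmatchings (H - {x} \<union> B). ?w (H - {x}) B M)"
      unfolding eq by (intro sum.cong) auto
    also have "\<dots> = coeff (hsum lab H0 ^ card B * Q) (mon lab (H - {x}))"
      using insert.prems(1) disj by (intro insert.IH) auto
    finally show "(\<Sum>M\<in>pmatchings (H \<union> B - {x}). ?w H (insert b B) (insert {b, x} M)) =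
        coeff (hsum lab H0 ^ card B * Q) (mon lab (H - {x}))" .
  qed simp
  \<comment> \<open>The choice of the partner \<open>x\<close> is one more factor
    \<open>hsum lab H0\<close>.\<close>
  also have "\<dots> = coeff (hsum lab H0 * (hsum lab H0 ^ card B * Q)) (mon lab H)"
    using coeff_hsum_mult[OF H0 insert.prems(1)] by simp
  finally show ?case using insert.hyps by (simp add: mult.assoc)
qed

section \<open>Matchings that form a tree\<close>

text \<open>Glues two half-edges to an edge; \<open>w h\<close> is the point to which the half-edge
  \<open>h\<close> is attached.\<close>

definition pair_ends :: "('h \<Rightarrow> 'c) \<Rightarrow> 'h set \<Rightarrow> 'c multiset" where
  "pair_ends w p = image_mset w (mset_set p)"

lemma size_pair_ends: "card p = 2 \<Longrightarrow> size (pair_ends w p) = 2"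
  by (simp add: pair_ends_def)

lemma pair_ends_doubleton: "a \<noteq> b \<Longrightarrow> pair_ends w {a, b} = {#w a, w b#}"
  by (simp add: pair_ends_def)

lemma image_mset_pair_ends: "image_mset f (pair_ends w p) = pair_ends (f \<circ> w) p"
  by (simp add: pair_ends_def multiset.map_comp)

text \<open>The degree of the merged point after the edge \<open>{h, h'}\<close> is contracted: the
  degrees add up, and the two half-edges of the contracted edge are gone.\<close>

lemma card_pmatching_fibres_merge:
  assumes "finite S" "h \<in> S" "h' \<in> S" "w h \<noteq> w h'"
  shows "int (card {s \<in> S - {h, h'}. merge (w h) (w h') (w s) = w h}) =
    int (card {s \<in> S. w s = w h}) + int (card {s \<in> S. w s = w h'}) - 2"
proof -
  have "{s \<in> S - {h, h'}. merge (w h) (w h') (w s) = w h} =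
      ({s \<in> S. w s = w h} - {h}) \<union> ({s \<in> S. w s = w h'} - {h'})"
    using assms(4) by (auto simp: merge_def)
  also have "card \<dots> = card ({s \<in> S. w s = w h} - {h}) + card ({s \<in> S. w s = w h'} - {h'})"
    using assms by (intro card_Un_disjoint) auto
  finally have "card {s \<in> S - {h, h'}. merge (w h) (w h') (w s) = w h} =
      card ({s \<in> S. w s = w h} - {h}) + card ({s \<in> S. w s = w h'} - {h'})" .
  moreover have "Suc (card ({s \<in> S. w s = w h} - {h})) = card {s \<in> S. w s = w h}"
    using assms by (intro card_Suc_Diff1) auto
  moreover have "Suc (card ({s \<in> S. w s = w h'} - {h'})) = card {s \<in> S. w s = w h'}"
    using assms by (intro card_Suc_Diff1) auto
  ultimately show ?thesis by linarith
qed

text \<open>Expands by the partner \<open>h'\<close> of \<open>h\<close>. The hypothesis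
  \<open>card\<close> says that a matching has exactly \<open>card K - 1\<close> pairs, so none may
  be wasted on a loop; a pair that is no loop is contracted.\<close>

lemma sum_pmatchings_connects_step:
  fixes w :: "'h \<Rightarrow> 'c"
  assumes K: "finite K" and S: "finite S" and w: "w ` S \<subseteq> K" and card: "card S + 2 = 2 * card K"
    and h: "h \<in> S"
  shows "(\<Sum>M\<in>pmatchings S. if connects K (pair_ends w) M then 1 else 0 :: int) =
    (\<Sum>h'\<in>S - {h}. if w h' = w h then 0 else \<Sum>M\<in>pmatchings (S - {h, h'}).
      if connects (K - {w h'}) (pair_ends (merge (w h) (w h') \<circ> w)) M then 1 else 0)"
proof -
  have ins: "insert h (S - {h}) = S" using h by blast
  have "(\<Sum>M\<in>pmatchings S. if connects K (pair_ends w) M then 1 else 0 :: int) =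
      (\<Sum>h'\<in>S - {h}. \<Sum>M\<in>pmatchings (S - {h} - {h'}).
        if connects K (pair_ends w) (insert {h, h'} M) then 1 else 0)"
    using sum_pmatchings_insert[of "S - {h}" h "\<lambda>M. if connects K (pair_ends w) M then 1 else 0"] S
    unfolding ins by simp
  also have "\<dots> = (\<Sum>h'\<in>S - {h}. if w h' = w h then 0 else \<Sum>M\<in>pmatchings (S - {h, h'}).
      if connects (K - {w h'}) (pair_ends (merge (w h) (w h') \<circ> w)) M then 1 else 0)"
  proof (rule sum.cong)
    fix h' assume h': "h' \<in> S - {h}"
    have eq: "S - {h} - {h'} = S - {h, h'}" by blast
    have e: "pair_ends w {h, h'} = {#w h, w h'#}" using h' by (intro pair_ends_doubleton) auto
    have iff: "connects K (pair_ends w) (insert {h, h'} M) \<longleftrightarrow>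
        w h' \<noteq> w h \<and> connects (K - {w h'}) (pair_ends (merge (w h) (w h') \<circ> w)) M"
      if M: "M \<in> pmatchings (S - {h, h'})" for M
    proof -
      have size: "size (pair_ends w p) = 2" if "p \<in> M" for p
        using card_pmatching_pair[OF M that] by (rule size_pair_ends)
      show ?thesis
      proof (cases "w h' = w h")
        case True
        \<comment> \<open>The pair is a loop, which would leave only \<open>card K - 2\<close> pairs
          to connect \<open>K\<close>.\<close>
        have "\<not> connects K (pair_ends w) M"
        proof
          assume "connects K (pair_ends w) M"
          then have "card K \<le> card M + 1"
            using S K size M by (intro connects_imp_card_le) (auto intro: finite_pmatching[rotated])
          moreover have "2 * card M = card (S - {h, h'})" using S M by (intro card_pmatching) auto
          moreover have "card (S - {h, h'}) + 2 = card S"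
            using h h' S card_Suc_Diff1[of S h] card_Suc_Diff1[of "S - {h}" h'] by (simp add: eq)
          ultimately show False using card by linarith
        qed
        then show ?thesis using True e connects_loop[of "pair_ends w" "{h, h'}" "w h" K M] by simp
      next
        case False
        have "merge (w h) (w h') ` K = K - {w h'}"
          using False h h' w by (auto simp: merge_def)
        then show ?thesis
          using connects_merge[of "pair_ends w" "{h, h'}" "w h" "w h'" M K, OF e size] False
          by (simp add: image_mset_pair_ends)
      qed
    qed
    show "(\<Sum>M\<in>pmatchings (S - {h} - {h'}).
          if connects K (pair_ends w) (insert {h, h'} M) then 1 else 0 :: int) =
        (if w h' = w h then 0 else \<Sum>M\<in>pmatchings (S - {h, h'}).
          if connects (K - {w h'}) (pair_ends (merge (w h) (w h') \<circ> w)) M then 1 else 0)"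
      unfolding eq using iff by (simp cong: sum.cong)
  qed simp
  finally show ?thesis .
qed

text \<open>
  A form of Cayley's formula with prescribed degrees: the matchings connecting the points of
  \<open>K\<close> are the trees on \<open>K\<close> in which the half-edges at \<open>C \<in> K\<close> are
  \<open>{h \<in> S. w h = C}\<close>. The induction contracts the edge containing a fixed half-edge.
\<close>

lemma sum_pmatchings_connects:
  fixes w :: "'h \<Rightarrow> 'c"
  assumes "finite K" "finite S" "w ` S \<subseteq> K" "card K = c + 2" "card S = 2 * (c + 1)"
  shows "(\<Sum>M\<in>pmatchings S. if connects K (pair_ends w) M then 1 else 0) =
    fact c * (\<Prod>C\<in>K. int (card {h \<in> S. w h = C}))"
  using assms
proof (induction c arbitrary: K S w)
  case 0
  then obtain h h' where S: "S = {h, h'}" "h \<noteq> h'" by (auto simp: card_2_iff)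
  have one: "int (card {s \<in> S. w s = C}) = (if w h = C then 1 else 0) + (if w h' = C then 1 else 0)" for C
  proof -
    have "{s \<in> S. w s = C} = (if w h = C then {h} else {}) \<union> (if w h' = C then {h'} else {})"
      using S by auto
    then show ?thesis using S by auto
  qed
  obtain C where K: "K = {w h, C}" "C \<noteq> w h"
  proof -
    have "w h \<in> K" using 0 S by auto
    then have "card (K - {w h}) = 1" using 0 by simp
    then obtain C where "K - {w h} = {C}" by (auto simp: card_1_singleton_iff)
    then show ?thesis using that[of C] \<open>w h \<in> K\<close> by auto
  qed
  have "(\<Sum>M\<in>pmatchings S. if connects K (pair_ends w) M then 1 else 0 :: int) =
      (\<Sum>h'\<in>S - {h}. if w h' = w h then 0 else \<Sum>M\<in>pmatchings (S - {h, h'}).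
        if connects (K - {w h'}) (pair_ends (merge (w h) (w h') \<circ> w)) M then 1 else 0)"
    using 0 S by (intro sum_pmatchings_connects_step) auto
  also have "S - {h} = {h'}" using S by auto
  finally have eq: "(\<Sum>M\<in>pmatchings S. if connects K (pair_ends w) M then 1 else 0 :: int) =
      (if w h' = w h then 0 else
        if connects (K - {w h'}) (pair_ends (merge (w h) (w h') \<circ> w)) {} then 1 else 0)"
    using S by simp
  have h': "w h' = w h \<or> w h' = C" using 0 S K by auto
  have prod: "(\<Prod>D\<in>K. int (card {s \<in> S. w s = D})) =
      int (card {s \<in> S. w s = w h}) * int (card {s \<in> S. w s = C})"
    unfolding K(1) using K(2) by simp
  show ?case
  proof (cases "w h' = w h")
    case True
    then show ?thesis unfolding eq prod unfolding one using K(2) by simp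
  next
    case False
    then have C: "w h' = C" using h' by blast
    then have "K - {w h'} = {w h}" unfolding K(1) using K(2) by blast
    then show ?thesis unfolding eq prod unfolding one using K(2) C by (simp add: connects_def)
  qed
next
  case (Suc c)
  then have "S \<noteq> {}" by auto
  then obtain h where h: "h \<in> S" by blast
  define n where "n C = int (card {s \<in> S. w s = C})" for C
  \<comment> \<open>The value that the induction hypothesis gives after the contraction of an edge
    from \<open>w h\<close> to \<open>C\<close>; the factor in the middle is the degree of the
    merged point.\<close>
  define f where "f C = fact c * (n (w h) + n C - 2) * (\<Prod>D\<in>K - {w h} - {C}. n D)" for C
  have wh: "w h \<in> K" using h Suc.prems by auto
  have term_eq: "(\<Sum>M\<in>pmatchings (S - {h, h'}).
      if connects (K - {w h'}) (pair_ends (merge (w h) (w h') \<circ> w)) M then 1 else 0) = f (w h')"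
    if h': "h' \<in> S - {h}" "w h' \<noteq> w h" for h'
  proof -
    let ?w = "merge (w h) (w h') \<circ> w" and ?S = "S - {h, h'}" and ?K = "K - {w h'}"
    have wh': "w h' \<in> K" using h' Suc.prems by auto
    have "(\<Sum>M\<in>pmatchings ?S. if connects ?K (pair_ends ?w) M then 1 else 0) =
        fact c * (\<Prod>D\<in>?K. int (card {s \<in> ?S. ?w s = D}))"
    proof (rule Suc.IH)
      show "?w ` ?S \<subseteq> ?K" using Suc.prems wh h'(2) by (auto simp: merge_def)
      show "card ?K = c + 2" using Suc.prems wh' by simp
      show "card ?S = 2 * (c + 1)"
        using Suc.prems h h' by (subst card_Diff_subset) auto
    qed (use Suc.prems in auto)
    also have "(\<Prod>D\<in>?K. int (card {s \<in> ?S. ?w s = D})) =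
        int (card {s \<in> ?S. ?w s = w h}) * (\<Prod>D\<in>?K - {w h}. int (card {s \<in> ?S. ?w s = D}))"
      using Suc.prems wh h' by (intro prod.remove) auto
    also have "int (card {s \<in> ?S. ?w s = w h}) = n (w h) + n (w h') - 2"
      using card_pmatching_fibres_merge[of S h h' w] Suc.prems h h' by (simp add: n_def)
    also have "(\<Prod>D\<in>?K - {w h}. int (card {s \<in> ?S. ?w s = D})) = (\<Prod>D\<in>K - {w h} - {w h'}. n D)"
    proof (rule prod.cong)
      fix D assume D: "D \<in> K - {w h} - {w h'}"
      then have "{s \<in> ?S. ?w s = D} = {s \<in> S. w s = D}" by (auto simp: merge_def)
      then show "int (card {s \<in> ?S. ?w s = D}) = n D" by (simp add: n_def)
    qed auto
    finally show ?thesis unfolding f_def by (simp only: mult.assoc)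
  qed
  have "(\<Sum>M\<in>pmatchings S. if connects K (pair_ends w) M then 1 else 0 :: int) =
      (\<Sum>h'\<in>S - {h}. if w h' = w h then 0 else \<Sum>M\<in>pmatchings (S - {h, h'}).
        if connects (K - {w h'}) (pair_ends (merge (w h) (w h') \<circ> w)) M then 1 else 0)"
    using Suc.prems h by (intro sum_pmatchings_connects_step) auto
  also have "\<dots> = (\<Sum>h'\<in>S - {h}. if w h' = w h then 0 else f (w h'))"
    by (intro sum.cong) (auto simp: term_eq)
  also have "\<dots> = (\<Sum>h'\<in>S. if w h' = w h then 0 else f (w h'))"
    using Suc.prems by (intro sum.mono_neutral_left) auto
  \<comment> \<open>The term depends only on the point to which the partner is attached, so partners
    are grouped by it. The resulting factor \<open>n C\<close> completes the degree product in
    \<open>f C\<close>.\<close>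
  also have "\<dots> = (\<Sum>C\<in>K. \<Sum>h'\<in>{s \<in> S. w s = C}. if w h' = w h then 0 else f (w h'))"
    using Suc.prems by (intro sum.group[symmetric]) auto
  also have "\<dots> = (\<Sum>C\<in>K. if C = w h then 0 else n C * f C)"
    by (intro sum.cong) (auto simp: n_def)
  also have "\<dots> = (\<Sum>C\<in>K - {w h}. n C * f C)"
    using Suc.prems wh by (intro sum.mono_neutral_cong_right) auto
  also have "\<dots> = (\<Sum>C\<in>K - {w h}. fact c * (\<Prod>D\<in>K - {w h}. n D) * (n (w h) - 2 + n C))"
  proof (rule sum.cong)
    fix C assume "C \<in> K - {w h}"
    then have "(\<Prod>D\<in>K - {w h}. n D) = n C * (\<Prod>D\<in>K - {w h} - {C}. n D)"
      using Suc.prems by (intro prod.remove) auto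
    then show "n C * f C = fact c * (\<Prod>D\<in>K - {w h}. n D) * (n (w h) - 2 + n C)"
      by (simp add: f_def algebra_simps)
  qed simp
  also have "\<dots> = fact c * (\<Prod>D\<in>K - {w h}. n D) * (\<Sum>C\<in>K - {w h}. n (w h) - 2 + n C)"
    by (simp add: sum_distrib_left)
  also have "(\<Sum>C\<in>K - {w h}. n (w h) - 2 + n C) = int (c + 2) * (n (w h) - 2) + (\<Sum>C\<in>K - {w h}. n C)"
    using Suc.prems wh by (simp add: sum.distrib)
  also have "(\<Sum>C\<in>K - {w h}. n C) = int (card S) - n (w h)"
  proof -
    have "(\<Sum>C\<in>K. card {s \<in> S. w s = C}) = card S"
      using Suc.prems by (intro sum_card_fibres) auto
    then have "(\<Sum>C\<in>K. n C) = int (card S)" unfolding n_def by (simp flip: of_nat_sum)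
    then show ?thesis using Suc.prems wh sum.remove[of K "w h" n] by simp
  qed
  \<comment> \<open>Here \<open>card S = 2 * (c + 2)\<close>, so the constants cancel. What remains
    supplies both the missing degree \<open>n (w h)\<close> and the step from \<open>fact c\<close>
    to \<open>fact (Suc c)\<close>.\<close>
  also have "int (c + 2) * (n (w h) - 2) + (int (card S) - n (w h)) = int (Suc c) * n (w h)"
    using Suc.prems by (simp add: algebra_simps)
  also have "fact c * (\<Prod>D\<in>K - {w h}. n D) * (int (Suc c) * n (w h)) =
      fact (Suc c) * (n (w h) * (\<Prod>D\<in>K - {w h}. n D))"
    by (simp add: algebra_simps)
  also have "n (w h) * (\<Prod>D\<in>K - {w h}. n D) = (\<Prod>D\<in>K. n D)"
    using Suc.prems wh by (intro prod.remove[symmetric]) auto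
  finally show ?case by (simp add: n_def)
qed

text \<open>A set of \<open>card K\<close> elements that reaches all points of \<open>K\<close>
  meets each fibre once, so it is the image of a unique choice function. This identifies the degree
  product in Cayley's formula with a number of terms of the star polynomial.\<close>

lemma card_transversals:
  assumes "finite K" "finite A" "w ` A \<subseteq> K"
  shows "card {B. B \<subseteq> A \<and> card B = card K \<and> K \<subseteq> w ` B} = (\<Prod>C\<in>K. card {h \<in> A. w h = C})"
proof -
  let ?P = "Pi\<^sub>E K (\<lambda>C. {h \<in> A. w h = C})"
  have wf: "w (f C) = C" "f C \<in> A" if "f \<in> ?P" "C \<in> K" for f C
    using PiE_mem[OF that] by auto
  have "inj_on (\<lambda>f. f ` K) ?P"
  proof (rule inj_onI)
    fix f g assume f: "f \<in> ?P" and g: "g \<in> ?P" and eq: "f ` K = g ` K"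
    show "f = g"
    proof (rule PiE_ext[OF f g])
      fix C assume C: "C \<in> K"
      then obtain D where D: "D \<in> K" "f C = g D" using eq by blast
      then show "f C = g C" using wf(1)[OF f C] wf(1)[OF g D(1)] by simp
    qed
  qed
  moreover have "(\<lambda>f. f ` K) ` ?P = {B. B \<subseteq> A \<and> card B = card K \<and> K \<subseteq> w ` B}"
  proof (intro equalityI subsetI)
    fix B assume "B \<in> (\<lambda>f. f ` K) ` ?P"
    then obtain f where f: "f \<in> ?P" "B = f ` K" by blast
    have "inj_on f K" by (rule inj_on_inverseI[of _ w]) (rule wf(1)[OF f(1)])
    moreover have "K \<subseteq> w ` f ` K"
    proof
      fix C assume "C \<in> K"
      then show "C \<in> w ` f ` K" using wf(1)[OF f(1)] by (metis imageI)
    qed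
    ultimately show "B \<in> {B. B \<subseteq> A \<and> card B = card K \<and> K \<subseteq> w ` B}"
      using wf(2)[OF f(1)] f(2) by (auto simp: card_image)
  next
    fix B assume "B \<in> {B. B \<subseteq> A \<and> card B = card K \<and> K \<subseteq> w ` B}"
    then have B: "B \<subseteq> A" "card B = card K" "w ` B = K" using assms by auto
    have "finite B" using B(1) assms(2) by (rule finite_subset)
    then have inj: "inj_on w B" using B by (intro eq_card_imp_inj_on) auto
    define f where "f = restrict (inv_into B w) K"
    have "f \<in> ?P"
    proof (rule PiE_I)
      fix C assume C: "C \<in> K"
      then have "inv_into B w C \<in> B" "w (inv_into B w C) = C"
        using B(3) by (simp_all add: inv_into_into f_inv_into_f)
      then show "f C \<in> {h \<in> A. w h = C}" using C B(1) by (auto simp: f_def)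
    qed (simp add: f_def)
    moreover have "B = f ` K"
      using B(3) inj by (auto simp: f_def image_image)
    ultimately show "B \<in> (\<lambda>f. f ` K) ` ?P" by blast
  qed
  ultimately have "card {B. B \<subseteq> A \<and> card B = card K \<and> K \<subseteq> w ` B} = card ?P"
    by (metis (no_types, lifting) card_image)
  also have "\<dots> = (\<Prod>C\<in>K. card {h \<in> A. w h = C})"
    using assms by (intro card_PiE)
  finally show ?thesis .
qed

section \<open>Completing forests by stars and by trees\<close>

lemma csum_nonzero:
  assumes "csum I g S \<noteq> 0" "finite I"
  shows "\<exists>c\<in>S \<rightarrow>\<^sub>E I. \<forall>i\<in>I. g i {s \<in> S. c s = i} \<noteq> 0"
proof (rule ccontr)
  assume "\<not> ?thesis"
  then have "(\<Prod>i\<in>I. g i {s \<in> S. c s = i}) = 0" if "c \<in> S \<rightarrow>\<^sub>E I" for c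
    using that assms(2) by (intro prod_zero) auto
  then show False using assms(1) by (simp add: csum_def)
qed

lemma csum_eq_0:
  assumes "finite I" "i \<in> I" "\<And>A. A \<subseteq> S \<Longrightarrow> g i A = 0"
  shows "csum I g S = 0"
proof (rule ccontr)
  assume "csum I g S \<noteq> 0"
  then obtain c where "g i {s \<in> S. c s = i} \<noteq> 0"
    using csum_nonzero[OF _ assms(1)] assms(2) by blast
  then show False using assms(3)[of "{s \<in> S. c s = i}"] by simp
qed

text \<open>
  With \<open>K\<close> the set of components of a forest and \<open>w h\<close> the component in which the edge \<open>h\<close> at \<open>u\<close> ends,
  these two indicators say that the forest is completed to a spanning tree by a star at \<open>u\<close>
  and by the new edges of a transition, respectively.
\<close>

definition star_count :: "nat \<Rightarrow> 'c set \<Rightarrow> ('h \<Rightarrow> 'c) \<Rightarrow> 'h set \<Rightarrow> int" where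
  "star_count b K w A = (if card A = b \<and> K \<subseteq> w ` A then 1 else 0)"

definition tree_count :: "nat \<Rightarrow> 'c set \<Rightarrow> ('h \<Rightarrow> 'c) \<Rightarrow> 'h set set \<Rightarrow> int" where
  "tree_count b K w M = (if card M + 1 = b \<and> connects K (pair_ends w) M then 1 else 0)"

lemma pmatching_size: "M \<in> pmatchings A \<Longrightarrow> p \<in> M \<Longrightarrow> size (pair_ends w p) = 2"
  by (rule size_pair_ends) (rule card_pmatching_pair)

text \<open>
  Cayley's formula \<open>T = S Y\<^bsup>c - 2\<^esup>\<close>, stated with a common factor \<open>r\<close> so that it also covers the case of one
  component, in which \<open>S = Y\<close> and \<open>T = 1\<close>.
\<close>

lemma star_tree_polynomial:
  assumes H: "finite H" "inj_on lab H" and K: "finite K" "K \<noteq> {}" and w: "w ` H \<subseteq> K"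
  shows "\<exists>r a d. a + card K = d + 2 \<and>
    (\<forall>A\<subseteq>H. coeff (r * hsum lab H ^ a) (mon lab A) = star_count (card K) K w A) \<and>
    (\<forall>A\<subseteq>H. coeff (r * hsum lab H ^ d) (mon lab A) =
      (\<Sum>M\<in>pmatchings A. tree_count (card K) K w M))"
proof (cases "card K = 1")
  case True
  then obtain C where C: "K = {C}" by (auto simp: card_1_singleton_iff)
  have star: "coeff (1 * hsum lab H ^ 1) (mon lab A) = star_count (card K) K w A" if A: "A \<subseteq> H" for A
  proof -
    have "card A = 1 \<Longrightarrow> K \<subseteq> w ` A"
      using A w C by (auto simp: card_1_singleton_iff)
    then show ?thesis
      using coeff_hsum_power[OF H A, of 1] True by (auto simp: star_count_def)
  qed
  have tree: "coeff (1 * hsum lab H ^ 0) (mon lab A) = (\<Sum>M\<in>pmatchings A. tree_count (card K) K w M)"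
    if A: "A \<subseteq> H" for A
  proof -
    have fin: "finite A" using A H by (auto intro: finite_subset)
    have "(\<Sum>M\<in>pmatchings A. tree_count (card K) K w M) = (if A = {} then 1 else 0)"
    proof (cases "A = {}")
      case False
      have "card M \<noteq> 0" if "M \<in> pmatchings A" for M
        using card_pmatching[OF fin that] False fin by auto
      then have "tree_count (card K) K w M = 0" if "M \<in> pmatchings A" for M
        using that True by (simp add: tree_count_def)
      then show ?thesis using False by simp
    qed (use C in \<open>simp add: tree_count_def connects_def\<close>)
    then show ?thesis using coeff_hsum_power[OF H A, of 0] fin by simp
  qed
  show ?thesis
    using True star tree by (intro exI[of _ 1] exI[of _ "1 :: nat"] exI[of _ "0 :: nat"]) simp
next
  case False
  moreover have "card K \<noteq> 0" using K by simp
  ultimately obtain c where c: "card K = c + 2"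
    by (metis One_nat_def add_2_eq_Suc' not0_implies_Suc)
  \<comment> \<open>The star polynomial \<open>S\<close>, given by its coefficients. It is used with
    \<open>a = 0\<close> and \<open>d = c\<close>.\<close>
  define r where "r = (\<Sum>A\<in>Pow H. Poly_Mapping.single (mon lab A) (star_count (card K) K w A))"
  have star: "coeff r (mon lab A) = star_count (card K) K w A" if "A \<subseteq> H" for A
    unfolding r_def using coeff_sum_single_mon[OF H that] .
  have tree: "coeff (r * hsum lab H ^ c) (mon lab A) = (\<Sum>M\<in>pmatchings A. tree_count (card K) K w M)"
    if A: "A \<subseteq> H" for A
  proof -
    have fin: "finite A" "inj_on lab A" using A H by (auto intro: finite_subset inj_on_subset)
    let ?T = "{B. B \<subseteq> A \<and> card B = card K \<and> K \<subseteq> w ` B}"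
    have "coeff (r * hsum lab H ^ c) (mon lab A) =
        (\<Sum>B\<in>Pow A. star_count (card K) K w B * (if card (A - B) = c then fact c else 0))"
      unfolding coeff_mult_mon[OF fin]
    proof (rule sum.cong)
      fix B assume "B \<in> Pow A"
      then have "B \<subseteq> H" "A - B \<subseteq> H" using A by auto
      then show "coeff r (mon lab B) * coeff (hsum lab H ^ c) (mon lab (A - B)) =
          star_count (card K) K w B * (if card (A - B) = c then fact c else 0)"
        by (simp add: star coeff_hsum_power[OF H])
    qed simp
    also have "\<dots> = (\<Sum>B\<in>?T. if card A = 2 * (c + 1) then fact c else 0)"
    proof (rule sum.mono_neutral_cong_right)
      fix B assume B: "B \<in> ?T"
      then have "card (A - B) + card B = card A"
        using fin by (metis (mono_tags, lifting) card_Diff_subset card_mono finite_subset le_add_diff_inverse2 mem_Collect_eq)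
      \<comment> \<open>\<open>B\<close> has \<open>c + 2\<close> elements, so its complement has
        \<open>c\<close> exactly when \<open>A\<close> has the \<open>2 * (c + 1)\<close> half-edges
        of a tree on \<open>c + 2\<close> points.\<close>
      then have "card (A - B) = c \<longleftrightarrow> card A = 2 * (c + 1)" using B c by auto
      then show "star_count (card K) K w B * (if card (A - B) = c then fact c else 0) =
          (if card A = 2 * (c + 1) then fact c else 0)"
        using B by (simp add: star_count_def)
    qed (use fin in \<open>auto simp: star_count_def\<close>)
    also have "\<dots> = (if card A = 2 * (c + 1) then fact c * int (card ?T) else 0)" by simp
    also have "\<dots> = (\<Sum>M\<in>pmatchings A. tree_count (card K) K w M)"
    proof (cases "card A = 2 * (c + 1)")
      case True
      have "w ` A \<subseteq> K" using A w by blast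
      then have "(\<Sum>M\<in>pmatchings A. if connects K (pair_ends w) M then 1 else 0) = fact c * int (card ?T)"
        using sum_pmatchings_connects[OF K(1) fin(1) _ c True] card_transversals[OF K(1) fin(1)]
        by simp
      moreover have "tree_count (card K) K w M = (if connects K (pair_ends w) M then 1 else 0)"
        if "M \<in> pmatchings A" for M
        using card_pmatching[OF fin(1) that] True c by (simp add: tree_count_def)
      ultimately show ?thesis using True by simp
    next
      case False
      have "tree_count (card K) K w M = 0" if "M \<in> pmatchings A" for M
        using card_pmatching[OF fin(1) that] False c by (simp add: tree_count_def)
      then show ?thesis using False by simp
    qed
    finally show ?thesis .
  qed
  show ?thesis
    using c star tree by (intro exI[of _ r] exI[of _ "0 :: nat"] exI[of _ c]) simp
qed

text \<open>The heart of the recursion, for one fixed colouring of the edges away from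
  \<open>u\<close> and \<open>v\<close>. In the application, \<open>b i = card (K i)\<close> says
  that class \<open>i\<close> is a forest; if one class is not, both sides vanish. For forests, both
  sides are coefficients of products of the polynomials from \<open>star_tree_polynomial\<close>,
  which differ at most in the power of \<open>Y\<close>.\<close>

lemma csum_star_eq_matchings_tree:
  fixes H B :: "'h set"
  assumes I: "finite I" and H: "finite H" and B: "finite B" "H \<inter> B = {}"
    and card: "card H + card B = 2 * card I"
    and K: "\<And>i. i \<in> I \<Longrightarrow> finite (K i) \<and> K i \<noteq> {} \<and> w i ` H \<subseteq> K i \<and> b i \<le> card (K i)"
  shows "csum I (\<lambda>i. star_count (b i) (K i) (w i)) H =
    (\<Sum>M\<in>pmatchings (H \<union> B). if \<exists>p\<in>M. p \<subseteq> B then 0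
      else csum I (\<lambda>i. tree_count (b i) (K i) (w i)) {p \<in> M. p \<subseteq> H})"
proof (cases "\<exists>i\<in>I. b i \<noteq> card (K i)")
  case True
  \<comment> \<open>Class \<open>i\<close> has too many components: a star reaching all of them
    needs at least \<open>card (K i)\<close> edges, and a tree on them at least
    \<open>card (K i) - 1\<close>.\<close>
  then obtain i where i: "i \<in> I" "b i < card (K i)" using K by (metis le_neq_implies_less)
  have "star_count (b i) (K i) (w i) A = 0" if "A \<subseteq> H" for A
  proof -
    have "\<not> (card A = b i \<and> K i \<subseteq> w i ` A)"
    proof
      assume *: "card A = b i \<and> K i \<subseteq> w i ` A"
      have fin: "finite A" using that H by (rule finite_subset)
      have "card (K i) \<le> card (w i ` A)" using * fin by (intro card_mono) auto
      also have "\<dots> \<le> card A" using fin by (rule card_image_le)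
      finally show False using * i by simp
    qed
    then show ?thesis by (simp add: star_count_def)
  qed
  then have L: "csum I (\<lambda>i. star_count (b i) (K i) (w i)) H = 0"
    by (rule csum_eq_0[OF I i(1)])
  have "csum I (\<lambda>i. tree_count (b i) (K i) (w i)) {p \<in> M. p \<subseteq> H} = 0"
    if M: "M \<in> pmatchings (H \<union> B)" for M
  proof (rule csum_eq_0[OF I i(1)], rule ccontr)
    fix N assume sub: "N \<subseteq> {p \<in> M. p \<subseteq> H}" and nz: "tree_count (b i) (K i) (w i) N \<noteq> 0"
    then have N: "N \<subseteq> M" "tree_count (b i) (K i) (w i) N \<noteq> 0" by auto
    have "finite N" using finite_pmatching[OF _ M] H B N(1) by (auto intro: finite_subset)
    moreover have conn: "connects (K i) (pair_ends (w i)) N" and cN: "card N + 1 = b i"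
      using N(2) by (simp_all add: tree_count_def split: if_splits)
    moreover have "size (pair_ends (w i) p) = 2" if "p \<in> N" for p
      using pmatching_size[OF M] N(1) that by blast
    ultimately have "card (K i) \<le> card N + 1"
      using K[OF i(1)] by (intro connects_imp_card_le[of _ "pair_ends (w i)"]) blast+
    then show False using cN i by simp
  qed
  then show ?thesis unfolding L by (intro sum.neutral[symmetric]) auto
next
  case False
  then have b: "b i = card (K i)" if "i \<in> I" for i using that by blast
  obtain lab :: "'h \<Rightarrow> nat" where lab: "inj_on lab H"
    using finite_imp_inj_to_nat_seg[OF H] by metis
  have "\<forall>i\<in>I. \<exists>r a d. a + card (K i) = d + 2 \<and>
    (\<forall>A\<subseteq>H. coeff (r * hsum lab H ^ a) (mon lab A) = star_count (card (K i)) (K i) (w i) A) \<and>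
    (\<forall>A\<subseteq>H. coeff (r * hsum lab H ^ d) (mon lab A) =
      (\<Sum>M\<in>pmatchings A. tree_count (card (K i)) (K i) (w i) M))"
    using K by (intro ballI star_tree_polynomial H lab) auto
  then obtain r a d where
    ad: "\<And>i. i \<in> I \<Longrightarrow> a i + card (K i) = d i + 2" and
    star: "\<And>i A. i \<in> I \<Longrightarrow> A \<subseteq> H \<Longrightarrow>
      coeff (r i * hsum lab H ^ a i) (mon lab A) = star_count (card (K i)) (K i) (w i) A" and
    tree: "\<And>i A. i \<in> I \<Longrightarrow> A \<subseteq> H \<Longrightarrow>
      coeff (r i * hsum lab H ^ d i) (mon lab A) =
        (\<Sum>M\<in>pmatchings A. tree_count (card (K i)) (K i) (w i) M)"
    unfolding bchoice_iff by metis
  let ?Y = "hsum lab H"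
  \<comment> \<open>The product of the tree polynomials; the edges \<open>uv\<close> contribute the
    further factor \<open>?Y ^ card B\<close>.\<close>
  define Q where "Q = (\<Prod>i\<in>I. r i * ?Y ^ d i)"
  have Q: "coeff Q (mon lab A) = csum I (\<lambda>i S. \<Sum>M\<in>pmatchings S. tree_count (b i) (K i) (w i) M) A"
    if A: "A \<subseteq> H" for A
  proof -
    have "finite A" "inj_on lab A" using A H lab by (auto intro: finite_subset inj_on_subset)
    then have "coeff Q (mon lab A) = csum I (\<lambda>i S. coeff (r i * ?Y ^ d i) (mon lab S)) A"
      unfolding Q_def using I by (intro coeff_prod_mon)
    also have "\<dots> = csum I (\<lambda>i S. \<Sum>M\<in>pmatchings S. tree_count (b i) (K i) (w i) M) A"
    proof (rule csum_cong)
      fix i S assume "i \<in> I" "S \<subseteq> A"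
      then show "coeff (r i * ?Y ^ d i) (mon lab S) =
          (\<Sum>M\<in>pmatchings S. tree_count (b i) (K i) (w i) M)"
        using tree[of i S] b A by auto
    qed
    finally show ?thesis .
  qed
  have L: "csum I (\<lambda>i. star_count (b i) (K i) (w i)) H = coeff (\<Prod>i\<in>I. r i * ?Y ^ a i) (mon lab H)"
    unfolding coeff_prod_mon[OF H lab I] using star b by (intro csum_cong) auto
  have R: "(\<Sum>M\<in>pmatchings (H \<union> B). if \<exists>p\<in>M. p \<subseteq> B then 0
      else csum I (\<lambda>i. tree_count (b i) (K i) (w i)) {p \<in> M. p \<subseteq> H}) =
      coeff (?Y ^ card B * Q) (mon lab H)"
  proof (rule sum_pmatchings_bipartite[OF H lab B(1) _ order_refl B(2)])
    fix A assume A: "A \<subseteq> H"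
    then have "finite A" using H by (rule finite_subset)
    then show "coeff Q (mon lab A) = (\<Sum>M\<in>pmatchings A. csum I (\<lambda>i. tree_count (b i) (K i) (w i)) M)"
      unfolding Q[OF A] by (rule sum_pmatchings_csum[OF I, symmetric])
  qed
  show ?thesis
  proof (cases "(\<Sum>i\<in>I. card (K i)) = card H")
    case True
    \<comment> \<open>Summing the relation between \<open>a\<close> and \<open>d\<close> and using
      that \<open>card H + card B = 2 * card I\<close> shows that the exponents of \<open>Y\<close>
      agree.\<close>
    have "(\<Sum>i\<in>I. a i + card (K i)) = (\<Sum>i\<in>I. d i + 2)" using ad by (intro sum.cong) auto
    then have "(\<Sum>i\<in>I. a i) = card B + (\<Sum>i\<in>I. d i)"
      using True card unfolding sum.distrib sum_constant by simp
    then have "(\<Prod>i\<in>I. r i * ?Y ^ a i) = ?Y ^ card B * Q"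
      by (simp add: Q_def prod.distrib power_add ac_simps flip: power_sum)
    then show ?thesis unfolding L R by simp
  next
    \<comment> \<open>Both coefficients vanish for reasons of degree. Stars use
      \<open>card (K i)\<close> elements of \<open>H\<close> for each \<open>i\<close>; trees use
      \<open>2 * card (K i) - 2\<close> each, besides the \<open>card B\<close> partners of
      \<open>B\<close>. Either count would force the excluded equality.\<close>
    case ne: False
    have "csum I (\<lambda>i. star_count (b i) (K i) (w i)) H = 0"
    proof (rule ccontr)
      assume "csum I (\<lambda>i. star_count (b i) (K i) (w i)) H \<noteq> 0"
      then obtain c where c: "c \<in> H \<rightarrow>\<^sub>E I"
          "\<forall>i\<in>I. star_count (b i) (K i) (w i) {s \<in> H. c s = i} \<noteq> 0"
        using csum_nonzero[OF _ I] by blast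
      have "(\<Sum>i\<in>I. card {s \<in> H. c s = i}) = (\<Sum>i\<in>I. card (K i))"
        using c(2) b by (intro sum.cong) (auto simp: star_count_def split: if_splits)
      moreover have "(\<Sum>i\<in>I. card {s \<in> H. c s = i}) = card H"
        using c(1) by (intro sum_card_fibres H I) auto
      ultimately show False using ne by simp
    qed
    moreover have "coeff (?Y ^ card B * Q) (mon lab H) = 0"
    proof (rule ccontr)
      assume "coeff (?Y ^ card B * Q) (mon lab H) \<noteq> 0"
      then obtain A where A: "A \<subseteq> H" "coeff (?Y ^ card B) (mon lab A) \<noteq> 0" "coeff Q (mon lab (H - A)) \<noteq> 0"
        unfolding coeff_mult_mon[OF H lab] by (metis (no_types, lifting) Pow_iff mult_eq_0_iff sum.neutral)
      have cA: "card A = card B"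
        using A(2) coeff_hsum_power[OF H lab A(1)] by (auto split: if_splits)
      obtain c where c: "c \<in> (H - A) \<rightarrow>\<^sub>E I" "\<forall>i\<in>I.
          (\<Sum>M\<in>pmatchings {s \<in> H - A. c s = i}. tree_count (b i) (K i) (w i) M) \<noteq> 0"
        using A(3) csum_nonzero[OF _ I] unfolding Q[OF Diff_subset] by blast
      have "card {s \<in> H - A. c s = i} + 2 = 2 * card (K i)" if i: "i \<in> I" for i
      proof -
        obtain M where M: "M \<in> pmatchings {s \<in> H - A. c s = i}" "tree_count (b i) (K i) (w i) M \<noteq> 0"
          using c(2) i by (meson sum.not_neutral_contains_not_neutral)
        have "2 * card M = card {s \<in> H - A. c s = i}"
          using H M(1) by (intro card_pmatching) auto
        then show ?thesis using M(2) b[OF i] by (auto simp: tree_count_def split: if_splits)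
      qed
      then have "(\<Sum>i\<in>I. card {s \<in> H - A. c s = i} + 2) = (\<Sum>i\<in>I. 2 * card (K i))"
        by (intro sum.cong) auto
      moreover have "(\<Sum>i\<in>I. card {s \<in> H - A. c s = i}) = card (H - A)"
        using c(1) H I by (intro sum_card_fibres) auto
      moreover have "card (H - A) + card A = card H"
        using A(1) H by (metis card_Diff_subset card_mono finite_subset le_add_diff_inverse2)
      ultimately show False
        using ne card cA unfolding sum.distrib sum_constant sum_distrib_left[symmetric] by simp
    qed
    ultimately show ?thesis unfolding R by simp
  qed
qed

section \<open>Resolving a vertex\<close>

text \<open>By \<open>coeff_kirchhoff_power\<close> this is the coefficient in the theorem, for any
  injective labelling.\<close>

definition tree_partitions :: "nat \<Rightarrow> ('v, 'e) mgraph \<Rightarrow> 'v \<Rightarrow> int" where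
  "tree_partitions k G v =
    csum {..<k} (\<lambda>_ T. if T \<in> mspanning_trees (mdelete G v) then 1 else 0) (medges (mdelete G v))"

lemma mgraph_wf_mdelete: "mgraph_wf G \<Longrightarrow> mgraph_wf (mdelete G v)"
  by (auto simp: mgraph_wf_def mdelete_def mincident_def)

text \<open>A loop away from \<open>v\<close> survives the deletion and would be a cycle of length 1
  in the tree that receives it.\<close>

lemma tree_partitions_loop:
  assumes "mloop_at G x" "x \<noteq> v"
  shows "tree_partitions k G v = 0"
proof (rule ccontr)
  assume "tree_partitions k G v \<noteq> 0"
  then obtain c where c: "c \<in> medges (mdelete G v) \<rightarrow>\<^sub>E {..<k}"
    and T: "\<forall>i<k. {e \<in> medges (mdelete G v). c e = i} \<in> mspanning_trees (mdelete G v)"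
    unfolding tree_partitions_def by (auto dest!: csum_nonzero split: if_splits)
  obtain e where e: "e \<in> medges G" "mends G e = {#x, x#}" using assms(1) by (auto simp: mloop_at_def)
  then have e': "e \<in> medges (mdelete G v)" using assms(2) by (simp add: mdelete_def mincident_def)
  let ?T = "{e' \<in> medges (mdelete G v). c e' = c e}"
  have "c e < k" using c e' by auto
  then have "mtree (mdelete G v\<lparr>medges := ?T\<rparr>)" using T by (simp add: mspanning_trees_def)
  moreover have "mcycle (mdelete G v\<lparr>medges := ?T\<rparr>) [x] [e]"
    using e e' by (simp add: mcycle_def mdelete_def)
  ultimately show False by (auto simp: mtree_def)
qed

text \<open>All edges run from the centre \<open>c\<close> into \<open>K\<close>, so a point of
  \<open>K\<close> is reached only if an edge ends there.\<close>

lemma connects_star: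
  assumes "\<And>e. e \<in> S \<Longrightarrow> ends e = {#c, w e#}" "c \<notin> K" "w ` S \<subseteq> K"
  shows "connects (insert c K) ends S \<longleftrightarrow> K \<subseteq> w ` S"
proof
  assume conn: "connects (insert c K) ends S"
  show "K \<subseteq> w ` S"
  proof
    fix C assume C: "C \<in> K"
    then have "(C, c) \<in> (edge_rel ends S)\<^sup>*" using conn by (auto simp: connects_def)
    moreover have "C \<noteq> c" using C assms(2) by blast
    ultimately obtain y where "(C, y) \<in> edge_rel ends S" by (metis converse_rtranclE)
    then obtain e where e: "e \<in> S" "{#c, w e#} = {#C, y#}" using assms(1) by (auto simp: edge_rel_def)
    then have "w e = C" using \<open>C \<noteq> c\<close> unfolding pair_mset_eq_iff by auto
    then show "C \<in> w ` S" using e(1) by blast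
  qed
next
  assume K: "K \<subseteq> w ` S"
  have c: "(c, x) \<in> (edge_rel ends S)\<^sup>*" if "x \<in> insert c K" for x
  proof (cases "x = c")
    case False
    then have "x \<in> w ` S" using that K by blast
    then obtain e where "e \<in> S" "x = w e" by blast
    then have "(c, x) \<in> edge_rel ends S" using assms(1) by (auto simp: edge_rel_def)
    then show ?thesis by blast
  qed simp
  show "connects (insert c K) ends S"
    unfolding connects_def using c edge_rel_rtrancl_sym by (metis insert_not_empty rtrancl_trans)
qed

lemma connects_image: "connects V ends (r ` N) \<longleftrightarrow> connects V (\<lambda>p. ends (r p)) N"
proof -
  have "edge_rel ends (r ` N) = edge_rel (\<lambda>p. ends (r p)) N" by (auto simp: edge_rel_def)
  then show ?thesis by (simp add: connects_def)
qed

definition other_end :: "('v, 'e) mgraph \<Rightarrow> 'v \<Rightarrow> 'e \<Rightarrow> 'v" where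
  "other_end G u e = (SOME w. mends G e = {#u, w#})"

lemma mends_other_end:
  assumes "mgraph_wf G" "e \<in> mincident G u"
  shows "mends G e = {#u, other_end G u e#}"
proof -
  have e: "e \<in> medges G" "u \<in># mends G e" using assms(2) by (auto simp: mincident_def)
  then obtain a b where ab: "mends G e = {#a, b#}" using assms(1) size_2_mset by (metis mgraph_wf_def)
  then have "mends G e = {#u, if a = u then b else a#}" using e(2) by (auto simp: add_mset_commute)
  then show ?thesis unfolding other_end_def by (rule someI)
qed

section \<open>The graphs given by the transitions at one vertex\<close>

locale resolution =
  fixes G :: "('v, 'e) mgraph" and k :: nat and u :: 'v
  assumes wf: "mgraph_wf G" and reg: "mregular (2 * k) G"
    and u: "u \<in> mverts G" "\<not> mloop_at G u"
begin

abbreviation "oth \<equiv> other_end G u"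
abbreviation "rep \<equiv> \<lambda>p. SOME e. e \<in> p"

lemma finite_mincident: "finite (mincident G x)"
  using wf by (auto simp: mgraph_wf_def mincident_def)

lemma oth:
  assumes "e \<in> mincident G u"
  shows "mends G e = {#u, oth e#}" "oth e \<noteq> u" "oth e \<in> mverts G"
proof -
  show *: "mends G e = {#u, oth e#}" by (rule mends_other_end[OF wf assms])
  have e: "e \<in> medges G" using assms by (simp add: mincident_def)
  then show "oth e \<noteq> u" using * u(2) by (auto simp: mloop_at_def)
  have "set_mset (mends G e) \<subseteq> mverts G" using e wf by (auto simp: mgraph_wf_def)
  then show "oth e \<in> mverts G" using * by simp
qed

lemma card_mincident_u: "card (mincident G u) = 2 * k"
  using card_mincident[OF wf u(2)] reg u(1) by (simp add: mregular_def)

lemma transition_pmatching: "\<tau> \<in> mtransitions G u \<longleftrightarrow> \<tau> \<in> pmatchings (mincident G u)"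
  by (simp add: mtransitions_def pmatchings_def)

context
  fixes \<tau>
  assumes \<tau>: "\<tau> \<in> mtransitions G u"
begin

lemma transition_pm: "\<tau> \<in> pmatchings (mincident G u)"
  using \<tau> transition_pmatching by blast

lemma rep_in: "p \<in> \<tau> \<Longrightarrow> rep p \<in> p"
  using card_pmatching_pair[OF transition_pm] by (metis card.empty some_in_eq zero_neq_numeral)

lemma pair_subset: "p \<in> \<tau> \<Longrightarrow> p \<subseteq> mincident G u"
  using Union_pmatching[OF transition_pm] by blast

lemma rep_mincident: "p \<in> \<tau> \<Longrightarrow> rep p \<in> mincident G u"
  using rep_in pair_subset by blast

lemma inj_rep: "inj_on rep \<tau>"
proof (rule inj_onI)
  fix p q assume "p \<in> \<tau>" "q \<in> \<tau>" "rep p = rep q"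
  then show "p = q" using disjoint_pmatching[OF transition_pm, of p q "rep p"] rep_in by metis
qed

lemma mends_mresolve_old: "e \<notin> mincident G u \<Longrightarrow> mends (mresolve G u \<tau>) e = mends G e"
  by (simp add: mresolve_def)

text \<open>The pairs are disjoint, so the chosen name lies in one pair only. Taking
  \<open>u\<close> away from both edges of the pair leaves their far ends.\<close>

lemma mends_mresolve_new:
  assumes p: "p \<in> \<tau>"
  shows "mends (mresolve G u \<tau>) (rep p) = pair_ends oth p"
proof -
  have "(THE q. q \<in> \<tau> \<and> rep p \<in> q) = p"
  proof (rule the_equality)
    show "p \<in> \<tau> \<and> rep p \<in> p" using p rep_in by blast
    show "q = p" if "q \<in> \<tau> \<and> rep p \<in> q" for q
      using disjoint_pmatching[OF transition_pm, of q p "rep p"] that p rep_in by blast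
  qed
  then have "mends (mresolve G u \<tau>) (rep p) = (\<Sum>e\<in>p. mends G e - {#u#})"
    using rep_mincident[OF p] by (simp add: mresolve_def)
  also have "\<dots> = (\<Sum>e\<in>p. {#oth e#})"
  proof (rule sum.cong)
    fix e assume "e \<in> p"
    then have "mends G e = {#u, oth e#}" using oth(1) pair_subset[OF p] by blast
    then show "mends G e - {#u#} = {#oth e#}" by simp
  qed simp
  also have "\<dots> = pair_ends oth p"
  proof -
    obtain a b where "p = {a, b}" "a \<noteq> b"
      using card_pmatching_pair[OF transition_pm p] unfolding card_2_iff by blast
    then show ?thesis by (simp add: pair_ends_doubleton)
  qed
  finally show ?thesis .
qed

lemma finite_\<tau>: "finite \<tau>"
  using finite_pmatching[OF finite_mincident transition_pm] .

lemma size_new: "p \<in> \<tau> \<Longrightarrow> size (pair_ends oth p) = 2"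
  using pmatching_size[OF transition_pm] .

lemma set_pair_ends: "p \<in> \<tau> \<Longrightarrow> set_mset (pair_ends oth p) = oth ` p"
  unfolding pair_ends_def using pair_subset finite_mincident[of u] finite_subset by fastforce

lemma medges_mresolve: "medges (mresolve G u \<tau>) = (medges G - mincident G u) \<union> rep ` \<tau>"
  by (simp add: mresolve_def)

lemma mverts_mresolve: "mverts (mresolve G u \<tau>) = mverts G - {u}"
  by (simp add: mresolve_def)

lemma mgraph_wf_mresolve: "mgraph_wf (mresolve G u \<tau>)"
  unfolding mgraph_wf_def mverts_mresolve medges_mresolve
proof (intro conjI ballI)
  fix e assume "e \<in> (medges G - mincident G u) \<union> rep ` \<tau>"
  then consider "e \<in> medges G - mincident G u" | p where "p \<in> \<tau>" "e = rep p" by blast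
  then have "size (mends (mresolve G u \<tau>) e) = 2 \<and> set_mset (mends (mresolve G u \<tau>) e) \<subseteq> mverts G - {u}"
  proof cases
    case 1
    then show ?thesis using wf by (auto simp: mends_mresolve_old mgraph_wf_def mincident_def)
  next
    case 2
    have "oth ` p \<subseteq> mverts G - {u}" using oth pair_subset[OF 2(1)] by auto
    then show ?thesis
      unfolding 2(2) mends_mresolve_new[OF 2(1)] set_pair_ends[OF 2(1)] using size_new[OF 2(1)] by simp
  qed
  then show "size (mends (mresolve G u \<tau>) e) = 2" "set_mset (mends (mresolve G u \<tau>) e) \<subseteq> mverts G - {u}"
    by auto
qed (use wf finite_\<tau> in \<open>auto simp: mgraph_wf_def\<close>)

text \<open>At a vertex other than \<open>u\<close>, the new edge counts as much as the two edges
  that it replaces.\<close>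

lemma mregular_mresolve: "mregular (2 * k) (mresolve G u \<tau>)"
  unfolding mregular_def mverts_mresolve
proof
  fix x assume x: "x \<in> mverts G - {u}"
  have fin: "finite (medges G)" using wf by (simp add: mgraph_wf_def)
  have "mdegree (mresolve G u \<tau>) x = (\<Sum>e\<in>medges G - mincident G u. count (mends (mresolve G u \<tau>) e) x) +
      (\<Sum>e\<in>rep ` \<tau>. count (mends (mresolve G u \<tau>) e) x)"
    unfolding mdegree_def medges_mresolve using fin finite_\<tau> rep_mincident
    by (intro sum.union_disjoint) auto
  also have "(\<Sum>e\<in>medges G - mincident G u. count (mends (mresolve G u \<tau>) e) x) =
      (\<Sum>e\<in>medges G - mincident G u. count (mends G e) x)"
    by (intro sum.cong) (auto simp: mends_mresolve_old)
  also have "(\<Sum>e\<in>rep ` \<tau>. count (mends (mresolve G u \<tau>) e) x) = (\<Sum>p\<in>\<tau>. \<Sum>e\<in>p. count (mends G e) x)"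
    unfolding sum.reindex[OF inj_rep] o_def
  proof (rule sum.cong)
    fix p assume p: "p \<in> \<tau>"
    then obtain a b where ab: "p = {a, b}" "a \<noteq> b"
      using card_pmatching_pair[OF transition_pm p] unfolding card_2_iff by blast
    then have "a \<in> mincident G u" "b \<in> mincident G u" using pair_subset[OF p] by auto
    then have "mends G a = {#u, oth a#}" "mends G b = {#u, oth b#}" using oth(1) by blast+
    then show "count (mends (mresolve G u \<tau>) (rep p)) x = (\<Sum>e\<in>p. count (mends G e) x)"
      unfolding mends_mresolve_new[OF p] using x ab by (auto simp: pair_ends_doubleton)
  qed simp
  also have "\<dots> = (\<Sum>e\<in>\<Union>\<tau>. count (mends G e) x)"
  proof -
    have "\<forall>p\<in>\<tau>. finite p" using pair_subset finite_mincident[of u] finite_subset by metis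
    moreover have "\<forall>p\<in>\<tau>. \<forall>q\<in>\<tau>. p \<noteq> q \<longrightarrow> p \<inter> q = {}" using disjoint_pmatching[OF transition_pm] by blast
    ultimately show ?thesis by (simp add: sum.Union_disjoint)
  qed
  also have "\<Union>\<tau> = mincident G u" by (rule Union_pmatching[OF transition_pm])
  also have "(\<Sum>e\<in>medges G - mincident G u. count (mends G e) x) + (\<Sum>e\<in>mincident G u. count (mends G e) x) =
      mdegree G x"
    unfolding mdegree_def using fin by (intro sum.subset_diff[symmetric]) (auto simp: mincident_def)
  also have "\<dots> = 2 * k" using reg x by (simp add: mregular_def)
  finally show "mdegree (mresolve G u \<tau>) x = 2 * k" .
qed

end

end

section \<open>Tree partitions before and after resolving a vertex\<close>

locale resolution_away = resolution +
  fixes v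
  assumes v: "v \<in> mverts G" "v \<noteq> u" "\<not> mloop_at G v" and third: "mverts G \<noteq> {u, v}"
begin

text \<open>In terms of the outline: the forests live in \<open>E\<close>, the variables are indexed
  by \<open>H\<close>, and \<open>B\<close> holds the \<open>m\<close> edges
  \<open>uv\<close>.\<close>

definition "E = medges G - mincident G u - mincident G v"
definition "H = mincident G u - mincident G v"
definition "B = mincident G u \<inter> mincident G v"
definition "V = mverts G - {u, v}"

text \<open>\<open>bound F\<close> is the number of edges at \<open>u\<close> that would complete
  \<open>F\<close> to a spanning tree on the \<open>card V + 1\<close> vertices of
  \<open>mdelete G v\<close>. The points \<open>parts F\<close> and the map \<open>attach F\<close>
  play the roles of \<open>K\<close> and \<open>w\<close> in \<open>star_count\<close> and
  \<open>tree_count\<close>.\<close>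

definition "bound F = card V - card F"
definition "parts F = component (mends G) F ` V"
definition "attach F = component (mends G) F \<circ> oth"

lemma finite_sets: "finite E" "finite H" "finite B" "finite V"
  using wf by (auto simp: mgraph_wf_def E_def H_def B_def V_def mincident_def)

lemma V_nonempty: "V \<noteq> {}"
  using third u v by (auto simp: V_def)

lemma mends_E: "e \<in> E \<Longrightarrow> size (mends G e) = 2 \<and> set_mset (mends G e) \<subseteq> V"
  using wf by (auto simp: mgraph_wf_def E_def V_def mincident_def)

lemma oth_H: "h \<in> H \<Longrightarrow> oth h \<in> V"
  using oth[of h] by (auto simp: H_def V_def mincident_def)

lemma oth_B: "h \<in> mincident G u \<Longrightarrow> h \<in> B \<longleftrightarrow> oth h = v"
  using oth[of h] v(2) by (auto simp: B_def mincident_def)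

lemma Un_HB: "mincident G u = H \<union> B" "H \<inter> B = {}"
  by (auto simp: H_def B_def)

lemma medges_delete: "medges (mdelete G v) = E \<union> H" "E \<inter> H = {}"
  by (auto simp: mdelete_def E_def H_def mincident_def)

lemma component_u_notin:
  assumes "F \<subseteq> E"
  shows "component (mends G) F u \<notin> parts F"
proof
  assume "component (mends G) F u \<in> parts F"
  then obtain x where x: "x \<in> V" "(u, x) \<in> (edge_rel (mends G) F)\<^sup>*"
    by (auto simp: parts_def component_eq_iff)
  moreover have "u \<noteq> x" using x(1) by (auto simp: V_def)
  ultimately obtain y where "(u, y) \<in> edge_rel (mends G) F" by (metis converse_rtranclE)
  then obtain e where "e \<in> F" "mends G e = {#u, y#}" by (auto simp: edge_rel_def)
  then show False using mends_E[of e] assms by (auto simp: V_def)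
qed

text \<open>Contracting \<open>F\<close> turns \<open>S\<close> into a star. Its centre, the
  component of \<open>u\<close>, is not among \<open>parts F\<close> because \<open>F\<close> avoids
  \<open>u\<close>.\<close>

lemma spanning_tree_star_iff:
  assumes F: "F \<subseteq> E" and S: "S \<subseteq> H"
  shows "(if F \<union> S \<in> mspanning_trees (mdelete G v) then 1 else 0) =
    star_count (bound F) (parts F) (attach F) S"
proof -
  let ?f = "component (mends G) F"
  have fin: "finite F" "finite S" using F S finite_sets by (auto intro: finite_subset)
  have verts: "mverts (mdelete G v) = insert u V" using u v by (auto simp: mdelete_def V_def)
  have "u \<notin> V" by (simp add: V_def)
  then have cV: "card (insert u V) = card V + 1" using finite_sets by simp
  have cFS: "card (F \<union> S) = card F + card S"
    using fin F S medges_delete(2) by (intro card_Un_disjoint) auto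
  have ends: "mends G h = {#u, oth h#}" if "h \<in> S" for h
    using oth(1)[of h] that S by (auto simp: H_def)
  have "connects (insert u V) (mends G) (F \<union> S) \<longleftrightarrow>
      connects (?f ` insert u V) (\<lambda>e. image_mset ?f (mends G e)) S"
    using ends by (intro connects_contract component_eq_iff) auto
  also have "?f ` insert u V = insert (?f u) (parts F)" by (simp add: parts_def)
  also have "connects (insert (?f u) (parts F)) (\<lambda>e. image_mset ?f (mends G e)) S \<longleftrightarrow>
      parts F \<subseteq> attach F ` S"
  proof (rule connects_star)
    show "attach F ` S \<subseteq> parts F" using oth_H S by (auto simp: attach_def parts_def)
  qed (use ends component_u_notin[OF F] in \<open>auto simp: attach_def\<close>)
  finally have conn: "connects (insert u V) (mends G) (F \<union> S) \<longleftrightarrow> parts F \<subseteq> attach F ` S" .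
  have "F \<union> S \<in> mspanning_trees (mdelete G v) \<longleftrightarrow>
      parts F \<subseteq> attach F ` S \<and> card F + card S = card V"
    unfolding mspanning_trees_eq[OF mgraph_wf_mdelete[OF wf]] verts cV mem_Collect_eq cFS medges_delete
    using conn F S by (auto simp: mdelete_def)
  also have "\<dots> \<longleftrightarrow> card S = bound F \<and> parts F \<subseteq> attach F ` S"
  proof (cases "card F \<le> card V")
    case True
    then show ?thesis by (auto simp: bound_def)
  next
    case False
    \<comment> \<open>Here the subtraction in \<open>bound F\<close> truncates to 0, but
      \<open>S\<close> cannot be empty when it has to reach a component.\<close>
    have "parts F \<noteq> {}" using V_nonempty by (simp add: parts_def)
    then have "parts F \<subseteq> attach F ` S \<Longrightarrow> card S \<noteq> 0" using fin by auto
    then show ?thesis using False by (auto simp: bound_def)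
  qed
  finally show ?thesis by (simp add: star_count_def)
qed

lemma tree_partitions_eq_star:
  "tree_partitions k G v = (\<Sum>c\<in>E \<rightarrow>\<^sub>E {..<k}. csum {..<k} (\<lambda>i.
    star_count (bound {e \<in> E. c e = i}) (parts {e \<in> E. c e = i}) (attach {e \<in> E. c e = i})) H)"
  unfolding tree_partitions_def medges_delete csum_Un[OF finite_sets(1,2) finite_lessThan medges_delete(2)]
  by (intro sum.cong csum_cong spanning_tree_star_iff) auto

context
  fixes \<tau>
  assumes \<tau>: "\<tau> \<in> mtransitions G u"
begin

text \<open>There is no loop at \<open>v\<close> in \<open>G\<close>, so a new one can only come
  from pairing two edges \<open>uv\<close>.\<close>

lemma mloop_at_mresolve: "mloop_at (mresolve G u \<tau>) v \<longleftrightarrow> (\<exists>p\<in>\<tau>. p \<subseteq> B)"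
proof
  assume "mloop_at (mresolve G u \<tau>) v"
  then obtain e where e: "e \<in> (medges G - mincident G u) \<union> rep ` \<tau>"
      "mends (mresolve G u \<tau>) e = {#v, v#}"
    unfolding mloop_at_def medges_mresolve[OF \<tau>] by blast
  have "e \<notin> medges G - mincident G u"
  proof
    assume "e \<in> medges G - mincident G u"
    then show False using e(2) v(3) mends_mresolve_old[OF \<tau>, of e] by (auto simp: mloop_at_def)
  qed
  then obtain p where p: "p \<in> \<tau>" "e = rep p" using e(1) by blast
  then have "pair_ends oth p = {#v, v#}" using e(2) mends_mresolve_new[OF \<tau>] by simp
  then have "oth ` p = {v}" using set_pair_ends[OF \<tau> p(1)] by simp
  then have "p \<subseteq> B" using oth_B pair_subset[OF \<tau> p(1)] by blast
  then show "\<exists>p\<in>\<tau>. p \<subseteq> B" using p(1) by blast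
next
  assume "\<exists>p\<in>\<tau>. p \<subseteq> B"
  then obtain p where p: "p \<in> \<tau>" "p \<subseteq> B" by blast
  then obtain a b where ab: "p = {a, b}" "a \<noteq> b"
    using card_pmatching_pair[OF transition_pm[OF \<tau>] p(1)] unfolding card_2_iff by blast
  then have "oth a = v" "oth b = v" using p oth_B pair_subset[OF \<tau> p(1)] by auto
  then have "mends (mresolve G u \<tau>) (rep p) = {#v, v#}"
    using mends_mresolve_new[OF \<tau> p(1)] ab by (simp add: pair_ends_doubleton)
  then show "mloop_at (mresolve G u \<tau>) v"
    using p(1) medges_mresolve[OF \<tau>] unfolding mloop_at_def by blast
qed

lemma medges_delete_mresolve:
  "medges (mdelete (mresolve G u \<tau>) v) = E \<union> rep ` {p \<in> \<tau>. p \<subseteq> H}"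
proof -
  have old: "e \<in> mincident (mresolve G u \<tau>) v \<longleftrightarrow> e \<in> mincident G v"
    if "e \<in> medges G - mincident G u" for e
    using that mends_mresolve_old[OF \<tau>] by (auto simp: mincident_def medges_mresolve[OF \<tau>])
  have new: "rep p \<in> mincident (mresolve G u \<tau>) v \<longleftrightarrow> \<not> p \<subseteq> H" if p: "p \<in> \<tau>" for p
  proof -
    have "rep p \<in> mincident (mresolve G u \<tau>) v \<longleftrightarrow> v \<in> oth ` p"
      using p mends_mresolve_new[OF \<tau> p] set_pair_ends[OF \<tau> p]
      by (auto simp: mincident_def medges_mresolve[OF \<tau>])
    also have "\<dots> \<longleftrightarrow> \<not> p \<subseteq> H"
      using oth_B pair_subset[OF \<tau> p] Un_HB by blast
    finally show ?thesis .
  qed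
  have "medges (mdelete (mresolve G u \<tau>) v) =
      ((medges G - mincident G u) \<union> rep ` \<tau>) - mincident (mresolve G u \<tau>) v"
    by (simp add: mdelete_def medges_mresolve[OF \<tau>])
  also have "\<dots> = E \<union> rep ` {p \<in> \<tau>. p \<subseteq> H}"
    using old new by (auto simp: E_def)
  finally show ?thesis .
qed

text \<open>The edges of \<open>F\<close> avoid \<open>u\<close> and keep their ends, so contracting
  \<open>F\<close> gives the same points as in \<open>G\<close>. The vertex \<open>u\<close> is
  gone, hence one edge less than in the star case.\<close>

lemma spanning_tree_mresolve_iff:
  assumes F: "F \<subseteq> E" and N: "N \<subseteq> {p \<in> \<tau>. p \<subseteq> H}"
  shows "(if F \<union> rep ` N \<in> mspanning_trees (mdelete (mresolve G u \<tau>) v) then 1 else 0) =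
    tree_count (bound F) (parts F) (attach F) N"
proof -
  let ?f = "component (mends G) F" and ?G = "mresolve G u \<tau>"
  have fin: "finite F" "finite N"
    using F N finite_sets finite_\<tau>[OF \<tau>] by (auto intro: finite_subset)
  have N\<tau>: "N \<subseteq> \<tau>" using N by auto
  have verts: "mverts (mdelete ?G v) = V"
    using u v by (auto simp: mdelete_def V_def mverts_mresolve[OF \<tau>])
  have inj: "inj_on rep N" using inj_rep[OF \<tau>] N\<tau> by (rule inj_on_subset)
  have "F \<inter> rep ` N = {}" using F N\<tau> rep_mincident[OF \<tau>] by (auto simp: E_def)
  then have cFN: "card (F \<union> rep ` N) = card F + card N"
    using fin by (simp add: card_Un_disjoint card_image[OF inj])
  have old: "mends ?G e = mends G e" if "e \<in> F" for e
    using mends_mresolve_old[OF \<tau>] that F by (auto simp: E_def)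
  have "edge_rel (mends ?G) F = edge_rel (mends G) F"
    using old by (rule edge_rel_cong)
  then have f: "?f a = ?f b \<longleftrightarrow> (a, b) \<in> (edge_rel (mends ?G) F)\<^sup>*" for a b
    by (simp add: component_eq_iff)
  have new: "mends ?G (rep p) = pair_ends oth p" if "p \<in> N" for p
    using mends_mresolve_new[OF \<tau>] that N\<tau> by auto
  have size: "size (mends ?G e) = 2" if "e \<in> rep ` N" for e
    using that new size_new[OF \<tau>] N\<tau> by auto
  have "connects V (mends ?G) (F \<union> rep ` N) \<longleftrightarrow>
      connects (parts F) (\<lambda>e. image_mset ?f (mends ?G e)) (rep ` N)"
    unfolding parts_def using f size by (rule connects_contract)
  also have "\<dots> \<longleftrightarrow> connects (parts F) (\<lambda>p. image_mset ?f (mends ?G (rep p))) N"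
    by (rule connects_image)
  also have "\<dots> \<longleftrightarrow> connects (parts F) (pair_ends (attach F)) N"
    using new by (intro connects_cong) (simp add: image_mset_pair_ends attach_def)
  finally have conn: "connects V (mends ?G) (F \<union> rep ` N) \<longleftrightarrow>
    connects (parts F) (pair_ends (attach F)) N" .
  have "F \<union> rep ` N \<in> mspanning_trees (mdelete ?G v) \<longleftrightarrow>
      connects (parts F) (pair_ends (attach F)) N \<and> card F + card N + 1 = card V"
    unfolding mspanning_trees_eq[OF mgraph_wf_mdelete[OF mgraph_wf_mresolve[OF \<tau>]]] verts
      mem_Collect_eq cFN medges_delete_mresolve
    using conn F N by (auto simp: mdelete_def)
  then show ?thesis by (auto simp: tree_count_def bound_def)
qed

lemma tree_partitions_mresolve:
  "tree_partitions k (mresolve G u \<tau>) v = (\<Sum>c\<in>E \<rightarrow>\<^sub>E {..<k}. csum {..<k} (\<lambda>i.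
    tree_count (bound {e \<in> E. c e = i}) (parts {e \<in> E. c e = i}) (attach {e \<in> E. c e = i}))
      {p \<in> \<tau>. p \<subseteq> H})"
proof -
  let ?N = "{p \<in> \<tau>. p \<subseteq> H}"
  have fin: "finite (rep ` ?N)" using finite_\<tau>[OF \<tau>] by simp
  have disj: "E \<inter> rep ` ?N = {}" using rep_mincident[OF \<tau>] by (auto simp: E_def)
  have inj: "inj_on rep ?N" using inj_rep[OF \<tau>] by (rule inj_on_subset) auto
  show ?thesis
    unfolding tree_partitions_def medges_delete_mresolve
      csum_Un[OF finite_sets(1) fin finite_lessThan disj] csum_image[OF inj]
    by (intro sum.cong csum_cong spanning_tree_mresolve_iff) auto
qed

end

text \<open>The comparison of stars and trees is applied to each colouring of \<open>E\<close>, and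
  the sums are exchanged. A loop at \<open>v\<close> disappears in \<open>mdelete\<close>, so the
  transitions creating one have to be excluded explicitly.\<close>

lemma tree_partitions_recursion:
  "tree_partitions k G v = (\<Sum>\<tau>\<in>mtransitions G u.
    if mloop_at (mresolve G u \<tau>) v then 0 else tree_partitions k (mresolve G u \<tau>) v)"
proof -
  let ?F = "\<lambda>c i. {e \<in> E. c e = i}"
  let ?t = "\<lambda>c i. tree_count (bound (?F c i)) (parts (?F c i)) (attach (?F c i))"
  have T: "mtransitions G u = pmatchings (H \<union> B)"
    using transition_pmatching Un_HB by auto
  have "tree_partitions k G v = (\<Sum>c\<in>E \<rightarrow>\<^sub>E {..<k}. \<Sum>\<tau>\<in>pmatchings (H \<union> B).
      if \<exists>p\<in>\<tau>. p \<subseteq> B then 0 else csum {..<k} (?t c) {p \<in> \<tau>. p \<subseteq> H})"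
    unfolding tree_partitions_eq_star
  proof (intro sum.cong csum_star_eq_matchings_tree)
    show "card H + card B = 2 * card {..<k}"
      using card_mincident_u finite_sets Un_HB by (simp add: card_Un_disjoint)
  next
    fix c i
    have "finite (?F c i)" using finite_sets(1) by simp
    then have "card V \<le> card (?F c i) + card (parts (?F c i))"
      unfolding parts_def using finite_sets(4) mends_E by (intro card_le_edges_plus_components) auto
    then have "bound (?F c i) \<le> card (parts (?F c i))" by (simp add: bound_def)
    moreover have "attach (?F c i) ` H \<subseteq> parts (?F c i)"
      using oth_H by (auto simp: attach_def parts_def)
    ultimately show "finite (parts (?F c i)) \<and> parts (?F c i) \<noteq> {} \<and>
        attach (?F c i) ` H \<subseteq> parts (?F c i) \<and> bound (?F c i) \<le> card (parts (?F c i))"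
      using finite_sets(4) V_nonempty by (simp add: parts_def)
  qed (use finite_sets Un_HB in auto)
  also have "\<dots> = (\<Sum>\<tau>\<in>pmatchings (H \<union> B). \<Sum>c\<in>E \<rightarrow>\<^sub>E {..<k}.
      if \<exists>p\<in>\<tau>. p \<subseteq> B then 0 else csum {..<k} (?t c) {p \<in> \<tau>. p \<subseteq> H})"
    by (rule sum.swap)
  also have "\<dots> = (\<Sum>\<tau>\<in>mtransitions G u.
      if mloop_at (mresolve G u \<tau>) v then 0 else tree_partitions k (mresolve G u \<tau>) v)"
    unfolding T[symmetric]
  proof (rule sum.cong)
    fix \<tau> assume \<tau>: "\<tau> \<in> mtransitions G u"
    show "(\<Sum>c\<in>E \<rightarrow>\<^sub>E {..<k}. if \<exists>p\<in>\<tau>. p \<subseteq> B then 0 else csum {..<k} (?t c) {p \<in> \<tau>. p \<subseteq> H}) =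
        (if mloop_at (mresolve G u \<tau>) v then 0 else tree_partitions k (mresolve G u \<tau>) v)"
      unfolding mloop_at_mresolve[OF \<tau>] tree_partitions_mresolve[OF \<tau>] by simp
  qed simp
  finally show ?thesis .
qed

end

section \<open>The Martin recursion\<close>

text \<open>\<open>tree_partitions\<close> does not see loops at \<open>v\<close>. Counting 0 for
  them as well follows the convention of the Martin invariant and makes the number independent of
  \<open>v\<close>.\<close>

definition loopfree_partitions :: "nat \<Rightarrow> ('v, 'e) mgraph \<Rightarrow> 'v \<Rightarrow> int" where
  "loopfree_partitions k G v = (if \<exists>x. mloop_at G x then 0 else tree_partitions k G v)"

lemma loopfree_partitions_eq: "\<not> mloop_at G v \<Longrightarrow> loopfree_partitions k G v = tree_partitions k G v"
  using tree_partitions_loop[of G _ v k] unfolding loopfree_partitions_def by metis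

lemma loopfree_partitions_recursion:
  assumes "mgraph_wf G" "mregular (2 * k) G" "u \<in> mverts G" "v \<in> mverts G" "v \<noteq> u"
    "mverts G \<noteq> {u, v}" "\<And>x. \<not> mloop_at G x"
  shows "loopfree_partitions k G v = (\<Sum>\<tau>\<in>mtransitions G u. loopfree_partitions k (mresolve G u \<tau>) v)"
proof -
  interpret resolution_away G k u v
    using assms by unfold_locales auto
  have "(if mloop_at G' v then 0 else tree_partitions k G' v) = loopfree_partitions k G' v" for G' :: "('a, 'b) mgraph"
    by (cases "mloop_at G' v") (auto simp: loopfree_partitions_eq, auto simp: loopfree_partitions_def)
  then show ?thesis
    using loopfree_partitions_eq[OF assms(7)] tree_partitions_recursion by simp
qed

section \<open>Graphs with two or three vertices\<close>

lemma medges_mdelete_two: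
  assumes "mgraph_wf G" "mverts G = {v, w}" "\<And>x. \<not> mloop_at G x"
  shows "medges (mdelete G v) = {}"
proof (rule ccontr)
  assume "medges (mdelete G v) \<noteq> {}"
  then obtain e where e: "e \<in> medges G" "v \<notin># mends G e" by (auto simp: mdelete_def mincident_def)
  then obtain a b where ab: "mends G e = {#a, b#}" using assms(1) size_2_mset by (metis mgraph_wf_def)
  have "set_mset (mends G e) \<subseteq> {v, w}" using assms(1,2) e(1) by (auto simp: mgraph_wf_def)
  then have "a = w" "b = w" using ab e(2) by auto
  then show False using ab e(1) assms(3) by (auto simp: mloop_at_def)
qed

lemma tree_partitions_two:
  assumes "mgraph_wf G" "mverts G = {v, w}" "v \<noteq> w" "\<And>x. \<not> mloop_at G x"
  shows "tree_partitions k G v = 1"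
proof -
  have "mverts (mdelete G v) = {w}" using assms(2,3) by (auto simp: mdelete_def)
  then have "{} \<in> mspanning_trees (mdelete G v)"
    unfolding mspanning_trees_eq[OF mgraph_wf_mdelete[OF assms(1)]] by (simp add: connects_def)
  then show ?thesis
    by (simp add: tree_partitions_def medges_mdelete_two[OF assms(1,2,4)])
qed

text \<open>After the deletion, \<open>k\<close> parallel edges join two vertices. Every spanning
  tree is a single edge, so the Kirchhoff polynomial is linear and the count is that of the orders
  of the edges.\<close>

lemma tree_partitions_three:
  assumes G: "mgraph_wf G" "mregular (2 * k) G" "card (mverts G) = 3" "v \<in> mverts G"
    and nl: "\<And>x. \<not> mloop_at G x"
  shows "tree_partitions k G v = fact k"
proof -
  let ?D = "mdelete G v"
  have fin: "finite (medges ?D)" using mgraph_wf_mdelete[OF G(1)] by (simp add: mgraph_wf_def)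
  obtain lab :: "'b \<Rightarrow> nat" where lab: "inj_on lab (medges ?D)"
    using finite_imp_inj_to_nat_seg[OF fin] by metis
  have card: "card (medges ?D) = k"
    using card_medges_mdelete[OF G(1,2,4) nl] G(3) by simp
  have "card (mverts ?D) = 2" using G by (simp add: mdelete_def)
  then obtain a b where ab: "mverts ?D = {a, b}" "a \<noteq> b" by (auto simp: card_2_iff)
  have tree: "T \<in> mspanning_trees ?D \<longleftrightarrow> card T = 1" if T: "T \<subseteq> medges ?D" for T
  proof -
    have "connects {a, b} (mends ?D) {e}" if e: "e \<in> medges ?D" for e
    proof -
      have "size (mends ?D e) = 2" "set_mset (mends ?D e) \<subseteq> {a, b}"
        using mgraph_wf_mdelete[OF G(1)] e ab(1) by (auto simp: mgraph_wf_def)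
      then obtain x y where xy: "mends ?D e = {#x, y#}" "x \<in> {a, b}" "y \<in> {a, b}"
        using size_2_mset by (metis insert_subset set_mset_add_mset_insert)
      moreover have "x \<noteq> y"
        using xy(1) e nl by (auto simp: mdelete_def mloop_at_def)
      ultimately have "(a, b) \<in> edge_rel (mends ?D) {e}" "(b, a) \<in> edge_rel (mends ?D) {e}"
        by (auto simp: edge_rel_def add_mset_commute)
      then show ?thesis by (auto simp: connects_def)
    qed
    then show ?thesis
      using ab T unfolding mspanning_trees_eq[OF mgraph_wf_mdelete[OF G(1)]]
      by (auto simp: card_1_singleton_iff)
  qed
  have "tree_partitions k G v = csum {..<k} (\<lambda>_ T. coeff (hsum lab (medges ?D)) (mon lab T)) (medges ?D)"
    unfolding tree_partitions_def
  proof (rule csum_cong)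
    fix i T assume T: "T \<subseteq> medges ?D"
    show "(if T \<in> mspanning_trees ?D then 1 else 0) = coeff (hsum lab (medges ?D)) (mon lab T)"
      using tree[OF T] coeff_hsum_power[OF fin lab T, of 1] by simp
  qed
  also have "\<dots> = coeff (\<Prod>i<k. hsum lab (medges ?D)) (mon lab (medges ?D))"
    by (rule coeff_prod_mon[symmetric]) (use fin lab in auto)
  also have "\<dots> = fact k"
    using coeff_hsum_power[OF fin lab order_refl, of k] card by simp
  finally show ?thesis .
qed

section \<open>Independence of the deleted vertex and comparison with the Martin invariant\<close>

lemma loopfree_partitions_independent:
  assumes "mgraph_wf G" "mregular (2 * k) G" "v \<in> mverts G" "w \<in> mverts G"
  shows "loopfree_partitions k G v = loopfree_partitions k G w"
  using assms
proof (induction "card (mverts G)" arbitrary: G rule: less_induct)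
  case less
  \<comment> \<open>For distinct \<open>v\<close> and \<open>w\<close> in a graph without loops, two
    vertices are the only case that lacks a third vertex \<open>u\<close> to expand at.\<close>
  consider "v = w" | "\<exists>x. mloop_at G x" | "v \<noteq> w" "mverts G = {v, w}" "\<And>x. \<not> mloop_at G x"
    | u where "u \<in> mverts G" "u \<noteq> v" "u \<noteq> w" "\<And>x. \<not> mloop_at G x"
    using less.prems by blast
  then show ?case
  proof cases
    case 3
    then have "mverts G = {w, v}" by blast
    then show ?thesis
      using 3 less.prems(1) tree_partitions_two[of G v w k] tree_partitions_two[of G w v k]
      by (simp add: loopfree_partitions_def)
  next
    case 4
    interpret resolution G k u using less.prems 4 by unfold_locales auto
    have "card (mverts G - {u}) < card (mverts G)"
      using 4(1) less.prems(1) by (intro psubset_card_mono) (auto simp: mgraph_wf_def)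
    then have IH: "loopfree_partitions k (mresolve G u \<tau>) v = loopfree_partitions k (mresolve G u \<tau>) w"
      if "\<tau> \<in> mtransitions G u" for \<tau>
      using less.hyps[of "mresolve G u \<tau>"] mgraph_wf_mresolve[OF that] mregular_mresolve[OF that]
        less.prems 4 by (simp add: mverts_mresolve[OF that])
    show ?thesis
    proof (cases "v = w")
      case False
      \<comment> \<open>The recursion needs a vertex besides \<open>u\<close> and the deleted one:
        \<open>w\<close> serves for \<open>v\<close>, and \<open>v\<close> for
        \<open>w\<close>.\<close>
      then have "mverts G \<noteq> {u, v}" "mverts G \<noteq> {u, w}"
        using 4(2,3) less.prems(3,4) by auto
      then have "loopfree_partitions k G x = (\<Sum>\<tau>\<in>mtransitions G u. loopfree_partitions k (mresolve G u \<tau>) x)"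
        if "x \<in> {v, w}" for x
        using that less.prems 4 by (intro loopfree_partitions_recursion) auto
      then show ?thesis using IH by simp
    qed simp
  qed (simp_all add: loopfree_partitions_def)
qed

lemma loopfree_partitions_martin:
  assumes "mgraph_wf G" "mregular (2 * k) G" "v \<in> mverts G" "card (mverts G) \<ge> 2"
  shows "of_int (loopfree_partitions k G v) = fact k * martin G"
  using assms
proof (induction "card (mverts G)" arbitrary: G v rule: less_induct)
  case less
  consider "\<exists>x. mloop_at G x" | "\<And>x. \<not> mloop_at G x" "card (mverts G) = 2"
    | "\<And>x. \<not> mloop_at G x" "card (mverts G) = 3" | "\<And>x. \<not> mloop_at G x" "card (mverts G) \<ge> 4"
    using less.prems(4) by fastforce
  then show ?case
  proof cases
    case 1
    then show ?thesis by (subst martin.simps) (simp add: loopfree_partitions_def)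
  next
    case 2
    then have "card (mverts G - {v}) = 1" using less.prems(3) by simp
    then obtain w where "mverts G - {v} = {w}" by (auto simp: card_1_singleton_iff)
    then have w: "mverts G = {v, w}" "v \<noteq> w" using less.prems(3) by blast+
    \<comment> \<open>All edges join the two vertices, so there are \<open>2 * k\<close> of them,
      and the value of \<open>martin\<close> is \<open>1 / fact k\<close>.\<close>
    have "medges G - mincident G v = {}"
      using medges_mdelete_two[OF less.prems(1) w(1) 2(1)] by (simp add: mdelete_def)
    then have "medges G = mincident G v" by (auto simp: mincident_def)
    then have "card (medges G) = 2 * k"
      using card_mincident[OF less.prems(1) 2(1), of v] less.prems(2,3) by (simp add: mregular_def)
    then have "martin G = 1 / fact k" using 2 by (subst martin.simps) simp
    then show ?thesis
      using tree_partitions_two[OF less.prems(1) w 2(1)] 2(1) by (simp add: loopfree_partitions_def)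
  next
    case 3
    then have "martin G = 1" by (subst martin.simps) simp
    then show ?thesis
      using tree_partitions_three[OF less.prems(1,2) 3(2) less.prems(3) 3(1)] 3(1)
      by (simp add: loopfree_partitions_def)
  next
    case 4
    define u where "u = (SOME u. u \<in> mverts G)"
    have u: "u \<in> mverts G" unfolding u_def using less.prems(3) by (rule someI)
    interpret resolution G k u using less.prems u 4 by unfold_locales auto
    have card: "card (mverts G - {u}) = card (mverts G) - 1" using u by simp
    then have "card (mverts G - {u}) \<noteq> 0" using 4(2) by simp
    \<comment> \<open>The vertex \<open>u\<close> chosen by \<open>martin\<close> may be
      \<open>v\<close>. The count is therefore moved to some \<open>w\<close> other than
      \<open>u\<close> before expanding at \<open>u\<close>.\<close>
    then obtain w where w: "w \<in> mverts G" "w \<noteq> u" by (auto simp: card_gt_0_iff)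
    have "mverts G \<noteq> {u, w}" using 4(2) w by auto
    then have "loopfree_partitions k G w = (\<Sum>\<tau>\<in>mtransitions G u. loopfree_partitions k (mresolve G u \<tau>) w)"
      using less.prems u w 4(1) by (intro loopfree_partitions_recursion) auto
    moreover have "loopfree_partitions k G v = loopfree_partitions k G w"
      using less.prems w by (intro loopfree_partitions_independent) auto
    moreover have "of_int (loopfree_partitions k (mresolve G u \<tau>) w) = fact k * martin (mresolve G u \<tau>)"
      if "\<tau> \<in> mtransitions G u" for \<tau>
      using mgraph_wf_mresolve[OF that] mregular_mresolve[OF that] w 4(2) card
      by (intro less.hyps) (simp_all add: mverts_mresolve[OF that])
    ultimately have "of_int (loopfree_partitions k G v) =
        (\<Sum>\<tau>\<in>mtransitions G u. fact k * martin (mresolve G u \<tau>))"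
      by simp
    also have "\<dots> = fact k * martin G"
      using 4 by (subst (2) martin.simps) (auto simp: u_def sum_distrib_left Let_def)
    finally show ?thesis .
  qed
qed

theorem theorem5p13:
  fixes G :: "('v, 'e) mgraph" and k n :: nat and v :: 'v and lab :: "'e \<Rightarrow> nat"
  assumes "mgraph_wf G"
    and "mregular (2 * k) G"
    and "card (mverts G) = n"
    and "n \<ge> 2"
    and "v \<in> mverts G"
    and "\<not> mloop_at G v"
    and "bij_betw lab (medges (mdelete G v)) {1..k * (n - 2)}"
  shows "of_int (Poly_Mapping.lookup (kirchhoff lab (mdelete G v) ^ k) (squarefree_monomial (k * (n - 2))))
       = fact k * martin G"
proof -
  \<comment> \<open>Reindexing along the bijection \<open>lab\<close> turns the monomial of all
    variables into the monomial of all edges.\<close>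
  have "squarefree_monomial (k * (n - 2)) = mon lab (medges (mdelete G v))"
    unfolding squarefree_monomial_def mon_def
    using sum.reindex_bij_betw[OF assms(7), of "\<lambda>i. Poly_Mapping.single i (1 :: nat)"] by simp
  moreover have "finite (medges (mdelete G v))"
    using mgraph_wf_mdelete[OF assms(1)] by (simp add: mgraph_wf_def)
  ultimately have "Poly_Mapping.lookup (kirchhoff lab (mdelete G v) ^ k) (squarefree_monomial (k * (n - 2))) =
      loopfree_partitions k G v"
    using coeff_kirchhoff_power bij_betw_imp_inj_on[OF assms(7)] loopfree_partitions_eq[OF assms(6)]
    by (simp add: tree_partitions_def)
  then show ?thesis
    using loopfree_partitions_martin[OF assms(1,2,5)] assms(3,4) by simp
qed

end
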